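(* Let $b\ge2$ be an integer and let $$\mathscr{H}_b=\{n\in\mathbb{Z}_{\ge1} : (n,b^3-b)=1,\ (\overleftarrow{n}_b,b^3-b)=1\}.$$ Then, as $x\to\infty$, $$\sum_{\substack{n\in\mathscr{H}_b(x)\\ n,\ \overleftarrow{n}_b\text{ are squarefree}}}1\sim\frac{\#\mathscr{H}_b(x)}{\zeta(2)^2}\prod_{p\mid b^3-b}\Big(1-\frac1{p^2}\Big)^{-2},$$ where the product is over primes $p$ dividing $b^3-b$.
   Context: For a positive integer $n$ written in base $b$ as $n=\sum_{j=0}^{k}n_jb^j$ with digits $n_j\in\{0,\ldots,b-1\}$ and $n_k\neq0$, the reverse of $n$ in base $b$ is $\overleftarrow{n}_b=\sum_{j=0}^{k}n_jb^{k-j}$. $(\cdot,\cdot)$ denotes the greatest common divisor. For a set of integers $\mathscr{A}$ and a positive real $x$, $\mathscr{A}(x)=\mathscr{A}\cap[1,x]$. $\zeta$ is the Riemann zeta function. *)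

theory Defs
  imports
    "HOL-Analysis.Analysis"
    "HOL-Library.Landau_Symbols"
    "HOL-Library.Log_Nat"
    "HOL-Computational_Algebra.Squarefree"
begin

definition digit :: "nat \<Rightarrow> nat \<Rightarrow> nat \<Rightarrow> nat" where
  "digit b n j = n div b ^ j mod b"

text \<open>
  For \<open>b \<ge> 2\<close> and \<open>n \<ge> 1\<close>, \<^term>\<open>floorlog b n\<close> is the number \<open>k + 1\<close> of base-\<open>b\<close> digits
  of \<open>n\<close>, so that \<open>k\<close> below is the index of the leading digit. The arguments \<open>b < 2\<close> and
  \<open>n = 0\<close> are irrelevant.
\<close>

definition reverse_base :: "nat \<Rightarrow> nat \<Rightarrow> nat" where
  "reverse_base b n = (let k = floorlog b n - 1 in \<Sum>j\<le>k. digit b n j * b ^ (k - j))"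

lemma digit_expansion:
  fixes b k :: nat and a :: "nat \<Rightarrow> nat"
  assumes "b \<ge> 2" and "\<And>j. j \<le> k \<Longrightarrow> a j < b"
  shows "(\<Sum>j\<le>k. a j * b ^ j) < b ^ Suc k"
    and "i \<le> k \<Longrightarrow> digit b (\<Sum>j\<le>k. a j * b ^ j) i = a i"
proof -
  have *: "(\<Sum>j\<le>m. c j * b ^ j) < b ^ Suc m" if "\<And>j. j \<le> m \<Longrightarrow> c j < b" for m c
    using that
  proof (induction m)
    case (Suc m)
    have "c (Suc m) * b ^ Suc m + b ^ Suc m \<le> b * b ^ Suc m"
      using Suc.prems[of "Suc m"] mult_le_mono1[of "Suc (c (Suc m))" b "b ^ Suc m"] by simp
    moreover have "(\<Sum>j\<le>m. c j * b ^ j) < b ^ Suc m"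
      using Suc by simp
    ultimately show ?case by simp
  qed auto
  show "(\<Sum>j\<le>k. a j * b ^ j) < b ^ Suc k" using * assms(2) by blast
  have "i \<le> m \<Longrightarrow> digit b (\<Sum>j\<le>m. c j * b ^ j) i = c i" if "\<And>j. j \<le> m \<Longrightarrow> c j < b" for m c i
    using that
  proof (induction i arbitrary: m c)
    case 0
    have "(\<Sum>j\<le>m. c j * b ^ j) = c 0 + b * (\<Sum>j<m. c (Suc j) * b ^ j)"
      by (simp add: sum.atMost_shift sum_distrib_left mult_ac)
    thus ?case using 0 by (simp add: digit_def)
  next
    case (Suc i)
    then obtain m' where m: "m = Suc m'" by (cases m) auto
    have "(\<Sum>j\<le>m. c j * b ^ j) = c 0 + b * (\<Sum>j\<le>m'. c (Suc j) * b ^ j)"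
      by (simp add: m sum.atMost_Suc_shift sum_distrib_left mult_ac del: sum.atMost_Suc)
    hence "digit b (\<Sum>j\<le>m. c j * b ^ j) (Suc i) = digit b (\<Sum>j\<le>m'. c (Suc j) * b ^ j) i"
      using Suc.prems(2)[of 0] assms(1) by (simp add: digit_def div_mult2_eq)
    thus ?case using Suc.IH[of m' "\<lambda>j. c (Suc j)"] Suc.prems m by simp
  qed
  thus "i \<le> k \<Longrightarrow> digit b (\<Sum>j\<le>k. a j * b ^ j) i = a i" using assms(2) by blast
qed

text \<open>The definition agrees with reversing any base-\<open>b\<close> expansion with nonzero leading digit.\<close>

lemma reverse_base_expansion:
  fixes b k :: nat and a :: "nat \<Rightarrow> nat"
  assumes "b \<ge> 2" and "\<And>j. j \<le> k \<Longrightarrow> a j < b" and "a k \<noteq> 0"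
  shows "reverse_base b (\<Sum>j\<le>k. a j * b ^ j) = (\<Sum>j\<le>k. a j * b ^ (k - j))"
proof -
  let ?n = "\<Sum>j\<le>k. a j * b ^ j"
  have "b ^ k \<le> a k * b ^ k" using assms(3) by simp
  also have "\<dots> \<le> ?n" by (rule member_le_sum) auto
  finally have "b ^ k \<le> ?n" .
  moreover have "?n < b ^ Suc k" using digit_expansion(1) assms(1,2) by blast
  ultimately have "floorlog b ?n = Suc k"
    using assms(1) by (intro antisym floorlog_leI floorlog_ge_SucI) auto
  thus ?thesis
    using digit_expansion(2)[of b k a] assms(1,2) by (simp add: reverse_base_def)
qed

definition H :: "nat \<Rightarrow> nat set" where
  "H b = {n. n \<ge> 1 \<and> gcd n (b ^ 3 - b) = 1 \<and> gcd (reverse_base b n) (b ^ 3 - b) = 1}"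

definition up_to :: "nat set \<Rightarrow> real \<Rightarrow> nat set" where
  "up_to A x = {n \<in> A. real n \<in> {1..x}}"

text \<open>The Riemann zeta function by its Dirichlet series, hence only for \<open>s > 1\<close>.\<close>

definition zeta :: "real \<Rightarrow> real" where
  "zeta s = (\<Sum>n. 1 / real (Suc n) powr s)"

end

theory Submission
  imports Defs "HOL-Number_Theory.Number_Theory"
begin

text \<open>
  Membership of \<open>n\<close> in \<open>H b\<close> only involves the extreme digits of \<open>n\<close> and its residue modulo
  \<open>b\<^sup>2 - 1\<close>, because the reverse of \<open>n\<close> is congruent to a power of \<open>b\<close> times \<open>n\<close> modulo \<open>b\<^sup>2 - 1\<close>.
  For \<open>q\<close> coprime to \<open>b\<^sup>3 - b\<close>, the digit at position \<open>j\<close> of a \<open>t\<close>-digit number \<open>r\<close> moves the pair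
  (\<open>r\<close> modulo \<open>(b\<^sup>2 - 1) q\<close>, reverse of \<open>r\<close> modulo \<open>q\<close>) along \<open>(b\<^sup>j, b\<^sup>t\<^sup>-\<^sup>1\<^sup>-\<^sup>j)\<close>; two consecutive such
  vectors generate all pairs of residues, so for suitable \<open>t\<close> every pair occurs. Prepending such a
  block of digits replaces the distribution of the pair by an average of its translates in which
  each translate has positive weight, so its oscillation contracts and the pair becomes
  equidistributed. Cutting \<open>[1, x]\<close> into blocks on which only a bounded number of low digits
  vary transfers this to \<open>H b\<close>: being divisible by none of the squares \<open>p\<^sup>2\<close>, \<open>p \<le> P\<close>, has
  independent and multiplicative densities for \<open>n\<close> and its reverse. Since reversal is injective
  on \<open>H b\<close> and increases numbers by a factor less than \<open>b\<close>, primes beyond \<open>P\<close> only affect \<open>O(x / P)\<close>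
  numbers, while \<open>H b\<close> has positive lower density.
\<close>

section \<open>Digit reversal\<close>

text \<open>Unlike \<open>reverse_base\<close>, the length \<open>s\<close> is prescribed, so
  leading zeros turn into trailing ones. Concatenation of blocks and induction on the length then
  need no case distinction on the leading digit.\<close>

primrec digit_reverse :: "nat \<Rightarrow> nat \<Rightarrow> nat \<Rightarrow> nat" where
  "digit_reverse b 0 r = 0"
| "digit_reverse b (Suc s) r = (r mod b) * b ^ s + digit_reverse b s (r div b)"

lemma digit_reverse_less:
  assumes "b > 0"
  shows "digit_reverse b s r < b ^ s"
proof (induction s arbitrary: r)
  case (Suc s)
  have "digit_reverse b (Suc s) r < (r mod b) * b ^ s + b ^ s"
    using Suc by simp
  also have "\<dots> = Suc (r mod b) * b ^ s" by simp
  also have "\<dots> \<le> b * b ^ s"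
    using assms by (intro mult_right_mono) (auto simp: Suc_le_eq)
  finally show ?case by simp
qed auto

lemma digit_reverse_append:
  assumes "r < b ^ s"
  shows "digit_reverse b (s + t) (r + b ^ s * m) = b ^ t * digit_reverse b s r + digit_reverse b t m"
  using assms
proof (induction s arbitrary: r)
  case (Suc s)
  have b: "b > 0" using Suc.prems by (cases b) auto
  have "r div b < b ^ s"
    using Suc.prems by (simp add: less_mult_imp_div_less mult.commute)
  moreover have "(r + b ^ Suc s * m) div b = r div b + b ^ s * m"
    using b by (simp add: mult.assoc)
  moreover have "(r + b ^ Suc s * m) mod b = r mod b"
    by (simp add: mult.assoc)
  ultimately show ?case
    using Suc.IH[of "r div b"] by (simp add: algebra_simps power_add)
qed auto

lemma digit_reverse_digit_reverse:
  assumes "r < b ^ s"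
  shows "digit_reverse b s (digit_reverse b s r) = r"
  using assms
proof (induction s arbitrary: r)
  case (Suc s)
  have b: "b > 0" using Suc.prems by (cases b) auto
  have 1: "r div b < b ^ s"
    using Suc.prems by (simp add: less_mult_imp_div_less mult.commute)
  have "digit_reverse b (s + 1) (digit_reverse b s (r div b) + b ^ s * (r mod b)) =
      b ^ 1 * digit_reverse b s (digit_reverse b s (r div b)) + digit_reverse b 1 (r mod b)"
    using b by (intro digit_reverse_append digit_reverse_less)
  also have "\<dots> = r"
    using Suc.IH[OF 1] by simp
  finally show ?case by (simp add: algebra_simps)
qed auto

lemma digit_reverse_eq_sum:
  "digit_reverse b (Suc k) r = (\<Sum>j\<le>k. digit b r j * b ^ (k - j))"
proof (induction k arbitrary: r)
  case (Suc k)
  have *: "digit b (r div b) j = digit b r (Suc j)" for j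
    by (simp add: digit_def div_mult2_eq)
  have "digit_reverse b (Suc (Suc k)) r = digit b r 0 * b ^ Suc k + digit_reverse b (Suc k) (r div b)"
    by (simp add: digit_def)
  also have "\<dots> = (\<Sum>j\<le>Suc k. digit b r j * b ^ (Suc k - j))"
    unfolding Suc.IH * by (subst sum.atMost_Suc_shift) simp
  finally show ?case .
qed (simp add: digit_def)

lemma reverse_base_eq_digit_reverse:
  assumes "b \<ge> 2" "n > 0"
  shows "reverse_base b n = digit_reverse b (floorlog b n) n"
proof -
  obtain k where "floorlog b n = Suc k"
    using assms floorlog_eq_zero_iff[of b n] by (cases "floorlog b n") auto
  then show ?thesis
    by (simp add: reverse_base_def digit_reverse_eq_sum del: digit_reverse.simps)
qed

lemma floorlog_append:
  assumes "b \<ge> 2" "m > 0" "r < b ^ s"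
  shows "floorlog b (r + b ^ s * m) = s + floorlog b m"
proof (rule antisym)
  have m: "b ^ (floorlog b m - 1) \<le> m" "m < b ^ floorlog b m"
    using floorlog_bounds[of m b] assms by auto
  have "r + b ^ s * m < b ^ s * Suc m" using assms by simp
  also have "\<dots> \<le> b ^ s * b ^ floorlog b m"
    using m(2) by (intro mult_left_mono) auto
  finally show "floorlog b (r + b ^ s * m) \<le> s + floorlog b m"
    using assms by (intro floorlog_leI) (auto simp: power_add)
  have "floorlog b m > 0" using assms floorlog_eq_zero_iff[of b m] by auto
  moreover have "b ^ s * b ^ (floorlog b m - 1) \<le> r + b ^ s * m"
    using m(1) by (intro trans_le_add2 mult_left_mono) auto
  ultimately show "s + floorlog b m \<le> floorlog b (r + b ^ s * m)"
    using assms by (intro floorlog_geI) (auto simp flip: power_add)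
qed

lemma reverse_base_append:
  assumes "b \<ge> 2" "m > 0" "r < b ^ s"
  shows "reverse_base b (r + b ^ s * m) = b ^ floorlog b m * digit_reverse b s r + reverse_base b m"
proof -
  have "r + b ^ s * m > 0" using assms by auto
  then show ?thesis
    using assms by (simp add: reverse_base_eq_digit_reverse floorlog_append digit_reverse_append)
qed

lemma reverse_base_less:
  assumes "b \<ge> 2" "n > 0"
  shows "reverse_base b n < b * n"
proof -
  have "floorlog b n > 0" using assms floorlog_eq_zero_iff[of b n] by auto
  then obtain k where k: "floorlog b n = Suc k" by (cases "floorlog b n") auto
  have "reverse_base b n < b ^ floorlog b n"
    using assms by (simp add: reverse_base_eq_digit_reverse digit_reverse_less)
  also have "\<dots> = b * b ^ (floorlog b n - 1)" using k by simp
  also have "\<dots> \<le> b * n" using floorlog_bounds[of n b] assms by simp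
  finally show ?thesis .
qed

text \<open>A nonzero last digit becomes a nonzero leading digit, so no digit is lost. This is what
  makes reversal an involution on the non-multiples of \<open>b\<close>.\<close>

lemma floorlog_reverse_base:
  assumes "b \<ge> 2" "\<not> b dvd n"
  shows "floorlog b (reverse_base b n) = floorlog b n"
proof -
  have n: "n > 0" using assms by (cases n) auto
  then obtain k where k: "floorlog b n = Suc k"
    using assms floorlog_eq_zero_iff[of b n] by (cases "floorlog b n") auto
  have eq: "reverse_base b n = digit_reverse b (Suc k) n"
    using assms n k by (simp add: reverse_base_eq_digit_reverse)
  have "n mod b > 0" using assms by (simp add: dvd_eq_mod_eq_0)
  then have "b ^ k \<le> reverse_base b n"
    unfolding eq by (simp add: trans_le_add1)
  moreover have "reverse_base b n < b ^ Suc k"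
    unfolding eq using assms by (intro digit_reverse_less) auto
  ultimately have "floorlog b (reverse_base b n) = Suc k"
    using assms by (intro antisym floorlog_leI floorlog_geI) auto
  with k show ?thesis by simp
qed

lemma reverse_base_reverse_base:
  assumes "b \<ge> 2" "\<not> b dvd n"
  shows "reverse_base b (reverse_base b n) = n"
proof -
  have n: "n > 0" using assms by (cases n) auto
  have "floorlog b n > 0" using assms n floorlog_eq_zero_iff[of b n] by auto
  then have "reverse_base b n > 0"
    using floorlog_reverse_base[OF assms] floorlog_eq_zero_iff[of b "reverse_base b n"] by auto
  then show ?thesis
    using assms n floorlog_bounds[of n b]
    by (simp add: reverse_base_eq_digit_reverse[of b "reverse_base b n"] floorlog_reverse_base)
       (simp add: reverse_base_eq_digit_reverse digit_reverse_digit_reverse)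
qed

lemma inj_on_reverse_base:
  assumes "b \<ge> 2"
  shows "inj_on (reverse_base b) {n. \<not> b dvd n}"
  using reverse_base_reverse_base[OF assms]
  by (intro inj_on_inverseI[where g = "reverse_base b"]) simp

text \<open>Modulo \<open>M\<close> the base is its own inverse, so moving a digit from weight
  \<open>b^j\<close> to \<open>b^(s-1-j)\<close> has the same effect as multiplying its contribution
  by \<open>b^(s-1)\<close>. The extra factor \<open>b\<close> on the left avoids the exponent
  \<open>s-1\<close>.\<close>

lemma cong_digit_reverse:
  assumes "[b * b = 1] (mod M)" "r < b ^ s"
  shows "[b * digit_reverse b s r = b ^ s * r] (mod M)"
  using assms(2)
proof (induction s arbitrary: r)
  case (Suc s)
  have 1: "r div b < b ^ s"
    using Suc.prems by (simp add: less_mult_imp_div_less mult.commute)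
  have "b * digit_reverse b (Suc s) r = b ^ Suc s * (r mod b) + b * digit_reverse b s (r div b)"
    by (simp add: algebra_simps)
  also have "[\<dots> = b ^ Suc s * (r mod b) + 1 * (b ^ s * (r div b))] (mod M)"
    using Suc.IH[OF 1] by (intro cong_add) auto
  also have "[b ^ Suc s * (r mod b) + 1 * (b ^ s * (r div b)) =
      b ^ Suc s * (r mod b) + (b * b) * (b ^ s * (r div b))] (mod M)"
    using assms(1) by (intro cong_add cong_mult cong_refl) (simp add: cong_sym)
  also have "b ^ Suc s * (r mod b) + (b * b) * (b ^ s * (r div b)) = b ^ Suc s * (r mod b + b * (r div b))"
    by (simp only: power_Suc distrib_left mult_ac)
  also have "\<dots> = b ^ Suc s * r" by (simp only: mod_mult_div_eq)
  finally show ?case .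
qed auto

section \<open>Arithmetic of \<open>b^3 - b\<close> and membership in \<open>H b\<close>\<close>

lemma cong_square_base: "b > 0 \<Longrightarrow> [b * b = 1] (mod (b * b - 1))" for b :: nat
  by (simp add: cong_altdef_nat)

lemma coprime_base: "b > 0 \<Longrightarrow> coprime b (b * b - 1)" for b :: nat
  using coprime_diff_one_right_nat[of "b * b"] by simp

lemma cube_minus_base: "b ^ 3 - b = b * (b * b - 1)" for b :: nat
  by (simp add: diff_mult_distrib2 power3_eq_cube mult.assoc)

lemma coprime_reverse_base_iff:
  assumes "b \<ge> 2" "n > 0"
  shows "coprime (reverse_base b n) (b * b - 1) \<longleftrightarrow> coprime n (b * b - 1)"
proof -
  let ?M = "b * b - 1" and ?s = "floorlog b n"
  have "[b * reverse_base b n = b ^ ?s * n] (mod ?M)"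
    using assms floorlog_bounds[of n b]
    by (simp only: reverse_base_eq_digit_reverse) (intro cong_digit_reverse cong_square_base; simp)
  then have "coprime (b * reverse_base b n) ?M \<longleftrightarrow> coprime (b ^ ?s * n) ?M"
    by (rule cong_gcd_eq[THEN arg_cong[where f = "\<lambda>x. x = 1"], unfolded coprime_iff_gcd_eq_1[symmetric]])
  then show ?thesis
    using assms coprime_base[of b] by (simp only: coprime_mult_left_iff coprime_power_left_iff) auto
qed

text \<open>Coprimality to \<open>b^3 - b = b * (b * b - 1)\<close> splits into two conditions, and
  the one modulo \<open>b * b - 1\<close> is the same for \<open>n\<close> and its reverse. The two
  conditions modulo \<open>b\<close> see only the last and the leading digit.\<close>

lemma mem_H_iff:
  assumes "b \<ge> 2"
  shows "n \<in> H b \<longleftrightarrow> n > 0 \<and> coprime n b \<and> coprime (reverse_base b n) b \<and> coprime n (b * b - 1)"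
  using coprime_reverse_base_iff[OF assms, of n]
  unfolding H_def cube_minus_base coprime_iff_gcd_eq_1[symmetric] coprime_mult_right_iff
  by (auto simp: Suc_le_eq)

section \<open>Joint distribution of a number and its reverse modulo \<open>q\<close>\<close>

lemma sum_lessThan_mult:
  "sum f {..<k * n} = (\<Sum>m<n. \<Sum>r<k. f (r + k * m))" for k n :: nat
proof -
  have "sum f {m * k..<m * k + k} = (\<Sum>r<k. f (r + k * m))" for m
    by (rule sum.reindex_bij_witness[of _ "\<lambda>r. r + k * m" "\<lambda>n. n - k * m"]) (auto simp: algebra_simps)
  then show ?thesis
    using sum.nat_group[of f k n] by (simp add: mult.commute)
qed

text \<open>Strings of \<open>t\<close> digits are counted with leading zeros allowed. The classes
  are integers so that they can be translated by subtraction. Two moduli occur because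
  \<open>n\<close> is also tracked modulo \<open>b * b - 1\<close>, its reverse only modulo
  \<open>q\<close>.\<close>

definition residue_density :: "nat \<Rightarrow> nat \<Rightarrow> nat \<Rightarrow> nat \<Rightarrow> int \<Rightarrow> int \<Rightarrow> real" where
  "residue_density b Q q t u w =
     (\<Sum>r<b ^ t. of_bool ([int r = u] (mod int Q) \<and> [int (digit_reverse b t r) = w] (mod int q))) / real (b ^ t)"

lemma residue_density_cong:
  assumes "[u = u'] (mod int Q)" "[w = w'] (mod int q)"
  shows "residue_density b Q q t u w = residue_density b Q q t u' w'"
  using assms unfolding residue_density_def by (simp add: cong_def)

lemma cong_diff_iff: "[x = y - z] (mod m) \<longleftrightarrow> [x + z = y] (mod m)" for x y z m :: int
  by (simp add: cong_iff_dvd_diff algebra_simps)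

text \<open>Under the two congruences the shifts caused by concatenation are trivial, so the residue
  pairs of the two blocks add up. The density for the longer string is therefore an average of
  translates.\<close>

lemma residue_density_add:
  assumes "b > 0" "[b ^ s = 1] (mod Q)" "[b ^ t = 1] (mod q)"
  shows "residue_density b Q q (s + t) u w =
    (\<Sum>m<b ^ t. residue_density b Q q s (u - int m) (w - int (digit_reverse b t m))) / real (b ^ t)"
proof -
  have *: "[int (r + b ^ s * m) = u] (mod int Q) \<and> [int (digit_reverse b (s + t) (r + b ^ s * m)) = w] (mod int q)
    \<longleftrightarrow> [int r = u - int m] (mod int Q) \<and>
       [int (digit_reverse b s r) = w - int (digit_reverse b t m)] (mod int q)"
    if "r < b ^ s" for r m
  proof -
    have "[r + b ^ s * m = r + 1 * m] (mod Q)"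
      by (intro cong_add cong_mult cong_refl assms)
    then have 1: "[int (r + b ^ s * m) = int r + int m] (mod int Q)"
      by (simp only: cong_int_iff flip: of_nat_add) simp
    have "[digit_reverse b (s + t) (r + b ^ s * m) = 1 * digit_reverse b s r + digit_reverse b t m] (mod q)"
      unfolding digit_reverse_append[OF that] by (intro cong_add cong_mult cong_refl assms)
    then have 2: "[int (digit_reverse b (s + t) (r + b ^ s * m)) =
        int (digit_reverse b s r) + int (digit_reverse b t m)] (mod int q)"
      by (simp only: cong_int_iff flip: of_nat_add) simp
    show ?thesis
      unfolding cong_diff_iff using 1 2 by (auto simp only: cong_def)
  qed
  have "(\<Sum>m<b ^ t. \<Sum>r<b ^ s. of_bool ([int (r + b ^ s * m) = u] (mod int Q) \<and>
        [int (digit_reverse b (s + t) (r + b ^ s * m)) = w] (mod int q))) =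
      (\<Sum>m<b ^ t. \<Sum>r<b ^ s. of_bool ([int r = u - int m] (mod int Q) \<and>
        [int (digit_reverse b s r) = w - int (digit_reverse b t m)] (mod int q)) :: real)"
    by (intro sum.cong refl) (simp only: * lessThan_iff)
  then show ?thesis
    unfolding residue_density_def power_add sum_lessThan_mult
    by (simp only: flip: sum_divide_distrib) (simp only: of_nat_mult divide_divide_eq_left)
qed

lemma digit_reverse_0 [simp]: "digit_reverse b s 0 = 0"
  by (induction s) auto

lemma digit_reverse_small:
  assumes "r < b"
  shows "digit_reverse b (Suc s) r = r * b ^ s"
  using assms by simp

lemma digit_reverse_mult_base:
  assumes "r < b"
  shows "digit_reverse b (Suc (Suc s)) (b * r) = r * b ^ s"
  using assms by simp

text \<open>Blocks of \<open>T\<close> digits representing \<open>1\<close> and \<open>b\<close> contribute \<open>(1, b\<^sup>-\<^sup>1)\<close> and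
  \<open>(b, b\<^sup>-\<^sup>2)\<close> to the pair of residues, wherever they are placed.\<close>

lemma exists_block_pattern:
  assumes b: "b \<ge> 2" and Q: "[b ^ T = 1] (mod Q)" and q: "[b ^ T = 1] (mod q)" and T: "T \<ge> 2"
    and "i + j \<le> k"
  shows "\<exists>r<b ^ (T * k). [r = i + b * j] (mod Q) \<and>
    [digit_reverse b (T * k) r = i * b ^ (T - 1) + j * b ^ (T - 2)] (mod q)"
  using \<open>i + j \<le> k\<close>
proof (induction k arbitrary: i j)
  case (Suc k)
  obtain s where s: "T = Suc (Suc s)" using T by (metis add_2_eq_Suc le_Suc_ex)
  \<comment> \<open>The new lowest block \<open>e\<close> will be \<open>0\<close>, \<open>1\<close>
    or \<open>b\<close>, which uses up \<open>(0, 0)\<close>, \<open>(1, 0)\<close> or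
    \<open>(0, 1)\<close> of the required \<open>(i, j)\<close>; the induction hypothesis supplies
    the remaining blocks.\<close>
  have step: ?case
    if e: "e < b ^ T" and eq: "i = i0 + i'" "j = j0 + j'" "i' + j' \<le> k"
      and e1: "e = i0 + b * j0" and e2: "digit_reverse b T e = i0 * b ^ (T - 1) + j0 * b ^ (T - 2)"
    for e i0 j0 i' j'
  proof -
    obtain r where r: "r < b ^ (T * k)" "[r = i' + b * j'] (mod Q)"
      "[digit_reverse b (T * k) r = i' * b ^ (T - 1) + j' * b ^ (T - 2)] (mod q)"
      using Suc.IH[OF eq(3)] by blast
    have "e + b ^ T * r < b ^ T * Suc r" using e by simp
    also have "\<dots> \<le> b ^ T * b ^ (T * k)" using r(1) by (intro mult_left_mono) auto
    also have "\<dots> = b ^ (T * Suc k)" by (simp add: power_add)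
    finally have "e + b ^ T * r < b ^ (T * Suc k)" .
    moreover have "[e + b ^ T * r = (i0 + b * j0) + 1 * (i' + b * j')] (mod Q)"
      unfolding e1 by (intro cong_add cong_mult r Q cong_refl)
    moreover have "[digit_reverse b (T + T * k) (e + b ^ T * r) =
        1 * (i0 * b ^ (T - 1) + j0 * b ^ (T - 2)) + (i' * b ^ (T - 1) + j' * b ^ (T - 2))] (mod q)"
      unfolding digit_reverse_append[OF e] e2
      using cong_pow[OF q, of k] by (intro cong_add cong_mult r cong_refl) (simp add: power_mult)
    ultimately show ?thesis
      unfolding eq by (intro exI[of _ "e + b ^ T * r"]) (auto simp: algebra_simps)
  qed
  have bT: "b < b ^ T" "1 < b ^ T" "0 < b ^ T"
    using b power_strict_increasing[of 1 T b] T one_less_power[of b T] by auto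
  consider "i + j \<le> k" | i' where "i = Suc i'" "i' + j \<le> k" | j' where "j = Suc j'" "i + j' \<le> k"
    using Suc.prems by (cases i; cases j) auto
  then show ?case
  proof cases
    case 1
    then show ?thesis by (intro step[of 0 0 i 0 j]) (use bT in auto)
  next
    case 2
    then show ?thesis
      using digit_reverse_small[of 1 b "Suc s"] b
      by (intro step[of 1 1 i' 0 j]) (use bT in \<open>auto simp: s simp del: digit_reverse.simps\<close>)
  next
    case 3
    then show ?thesis
      using digit_reverse_mult_base[of 1 b s] b
      by (intro step[of b 0 i 1 j']) (use bT in \<open>auto simp: s simp del: digit_reverse.simps\<close>)
  qed
qed auto

text \<open>One has to solve \<open>i + b j = u\<close> modulo \<open>Q\<close> and
  \<open>i b^-1 + j b^-2 = w\<close> modulo \<open>q\<close>. Eliminating \<open>i\<close> leaves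
  \<open>(b^2 - 1) j = b u - b^2 w\<close> modulo \<open>q\<close>, which is solvable because
  \<open>b^2 - 1\<close> is a unit there; the first equation then determines
  \<open>i\<close>.\<close>

lemma exists_covering_length:
  assumes b: "b \<ge> 2" and q: "q > 0" "coprime b q" "coprime (b * b - 1) q"
    and Q: "Q > 0" "coprime b Q" "q dvd Q"
  obtains t where "[b ^ t = 1] (mod Q)" "[b ^ t = 1] (mod q)"
    "\<And>u w :: int. \<exists>r<b ^ t. [int r = u] (mod int Q) \<and> [int (digit_reverse b t r) = w] (mod int q)"
proof -
  \<comment> \<open>The factor \<open>2\<close> guarantees \<open>T >= 2\<close>, as a block must
    have room for the two digits of \<open>b\<close>.\<close>
  define T where "T = 2 * totient Q"
  have T: "T \<ge> 2" using Q by (simp add: T_def Suc_le_eq)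
  have TQ: "[b ^ T = 1] (mod Q)"
    using cong_pow[OF euler_theorem[OF Q(2)], of 2] by (simp add: T_def power_mult mult.commute)
  then have Tq: "[b ^ T = 1] (mod q)" using Q(3) by (rule cong_dvd_modulus_nat)
  \<comment> \<open>Both \<open>i\<close> and \<open>j\<close> will be reduced below
    \<open>Q\<close>, so \<open>2 * Q\<close> blocks of length \<open>T\<close> suffice for every
    pair \<open>(u, w)\<close>.\<close>
  define t where "t = T * (2 * Q)"
  show thesis
  proof (rule that[of t])
    show "[b ^ t = 1] (mod Q)" "[b ^ t = 1] (mod q)"
      using cong_pow[OF TQ, of "2 * Q"] cong_pow[OF Tq, of "2 * Q"] by (simp_all add: t_def power_mult)
    fix u w :: int
    define B where "B = int b"
    have cop: "coprime (B * B - 1) (int q)"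
    proof -
      have "B * B - 1 = int (b * b - 1)" using b by (simp add: B_def of_nat_diff)
      then show ?thesis using q(3) by simp
    qed
    obtain x where x: "[(B * B - 1) * x = 1] (mod int q)"
      using cong_solve_coprime_int[OF cop] by blast
    define j where "j = nat ((x * (B * u - B * B * w)) mod int Q)"
    define i where "i = nat ((u - B * int j) mod int Q)"
    have j: "[int j = x * (B * u - B * B * w)] (mod int q)"
      using Q by (auto simp: j_def intro: cong_dvd_modulus[of _ _ "int Q"])
    have iQ: "[int i = u - B * int j] (mod int Q)" using Q by (auto simp: i_def)
    then have i: "[int i = u - B * int j] (mod int q)" using Q by (auto intro: cong_dvd_modulus)
    have "i + j \<le> 2 * Q"
    proof -
      have "i < Q" "j < Q" using Q by (auto simp: i_def j_def nat_less_iff)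
      then show ?thesis by simp
    qed
    then obtain r where r: "r < b ^ t" "[r = i + b * j] (mod Q)"
        "[digit_reverse b t r = i * b ^ (T - 1) + j * b ^ (T - 2)] (mod q)"
      using exists_block_pattern[OF b TQ Tq T] unfolding t_def by blast
    have "[int r = int i + B * int j] (mod int Q)"
      using r(2) by (simp add: B_def flip: cong_int_iff)
    also have "[int i + B * int j = (u - B * int j) + B * int j] (mod int Q)"
      by (intro cong_add iQ cong_refl)
    finally have 1: "[int r = u] (mod int Q)" by simp
    obtain s where s: "T = Suc (Suc s)" using T by (metis add_2_eq_Suc le_Suc_ex)
    have "[(B * B) * int (digit_reverse b t r) = (B * B) * (int i * B ^ (T - 1) + int j * B ^ (T - 2))] (mod int q)"
      using r(3) by (intro cong_mult cong_refl) (simp add: B_def flip: cong_int_iff)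
    also have "(B * B) * (int i * B ^ (T - 1) + int j * B ^ (T - 2)) = B ^ T * (B * int i + int j)"
      by (simp add: s algebra_simps)
    also have "[B ^ T * (B * int i + int j) = 1 * (B * (u - B * int j) + int j)] (mod int q)"
      using Tq by (intro cong_mult cong_add i cong_refl) (simp add: B_def flip: cong_int_iff)
    also have "1 * (B * (u - B * int j) + int j) = B * u - (B * B - 1) * int j"
      by (simp add: algebra_simps)
    also have "[B * u - (B * B - 1) * int j = B * u - (B * B - 1) * (x * (B * u - B * B * w))] (mod int q)"
      by (intro cong_diff cong_mult j cong_refl)
    also have "B * u - (B * B - 1) * (x * (B * u - B * B * w)) =
        B * u - ((B * B - 1) * x) * (B * u - B * B * w)" by (simp add: mult.assoc)
    also have "[B * u - ((B * B - 1) * x) * (B * u - B * B * w) = B * u - 1 * (B * u - B * B * w)] (mod int q)"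
      by (intro cong_diff cong_mult x cong_refl)
    finally have "[(B * B) * int (digit_reverse b t r) = (B * B) * w] (mod int q)" by simp
    then have "[int (digit_reverse b t r) = w] (mod int q)"
      using q(2) by (subst (asm) cong_mult_lcancel) (auto simp: B_def)
    with 1 r(1) show "\<exists>r<b ^ t. [int r = u] (mod int Q) \<and> [int (digit_reverse b t r) = w] (mod int q)"
      by blast
  qed
qed

text \<open>Each density for \<open>k + 1\<close> blocks is an average of \<open>b^t\<close>
  densities for \<open>k\<close> blocks. By \<open>cover\<close> one of these is always the same
  number, while the others lie in \<open>[l, h]\<close>, so the length of the interval shrinks by
  the factor \<open>1 - 1 / b^t\<close>.\<close>

lemma exists_density_bounds:
  assumes b: "b > 0" and Q: "[b ^ t = 1] (mod Q)" and q: "[b ^ t = 1] (mod q)"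
    and cover: "\<And>u w :: int. \<exists>r<b ^ t. [int r = u] (mod int Q) \<and> [int (digit_reverse b t r) = w] (mod int q)"
  shows "\<exists>l h. (\<forall>u w. l \<le> residue_density b Q q (t * k) u w \<and> residue_density b Q q (t * k) u w \<le> h) \<and>
    h - l = (1 - 1 / real (b ^ t)) ^ k"
proof (induction k)
  case 0
  have "0 \<le> residue_density b Q q (t * 0) u w \<and> residue_density b Q q (t * 0) u w \<le> 1" for u w
    by (simp add: residue_density_def)
  then show ?case by (intro exI[of _ 0] exI[of _ 1]) auto
next
  case (Suc k)
  let ?D = "\<lambda>k. residue_density b Q q (t * k)"
  define N where "N = real (b ^ t)"
  have N: "N \<ge> 1" using b by (simp add: N_def)
  from Suc obtain l h where lh: "\<And>u w. l \<le> ?D k u w" "\<And>u w. ?D k u w \<le> h" "h - l = (1 - 1 / N) ^ k"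
    by (auto simp: N_def)
  \<comment> \<open>The common term of all averages: for given \<open>(u, w)\<close>, a block
    \<open>m0\<close> with exactly these residues translates the pair to
    \<open>(0, 0)\<close>.\<close>
  define v where "v = ?D k 0 0"
  have *: "(v + (N - 1) * l) / N \<le> ?D (Suc k) u w \<and> ?D (Suc k) u w \<le> (v + (N - 1) * h) / N" for u w
  proof -
    obtain m0 where m0: "m0 < b ^ t" "[int m0 = u] (mod int Q)" "[int (digit_reverse b t m0) = w] (mod int q)"
      using cover by blast
    let ?f = "\<lambda>m. ?D k (u - int m) (w - int (digit_reverse b t m))"
    have "?f m0 = v"
      unfolding v_def using m0(2,3)
      by (intro residue_density_cong) (auto simp: cong_iff_dvd_diff dvd_diff_commute)
    then have sum: "(\<Sum>m<b ^ t. ?f m) = v + (\<Sum>m\<in>{..<b ^ t} - {m0}. ?f m)"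
      using m0(1) by (subst sum.remove[of _ m0]) auto
    have card: "real (card ({..<b ^ t} - {m0})) = N - 1"
      using m0(1) b by (simp add: N_def of_nat_diff)
    have "(N - 1) * l \<le> (\<Sum>m\<in>{..<b ^ t} - {m0}. ?f m)"
      unfolding card[symmetric] by (intro sum_bounded_below lh)
    moreover have "(\<Sum>m\<in>{..<b ^ t} - {m0}. ?f m) \<le> (N - 1) * h"
      unfolding card[symmetric] by (intro sum_bounded_above lh)
    moreover have "?D (Suc k) u w = (\<Sum>m<b ^ t. ?f m) / N"
      using residue_density_add[of b "t * k" Q t q u w] cong_pow[OF Q, of k] b q
      by (simp add: N_def power_mult add.commute)
    ultimately show ?thesis
      unfolding sum using N by (auto intro!: divide_right_mono)
  qed
  moreover have "(v + (N - 1) * h) / N - (v + (N - 1) * l) / N = (1 - 1 / N) * (h - l)"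
    using N by (simp add: field_simps)
  ultimately show ?case
    unfolding lh(3) N_def[symmetric] power_Suc by blast
qed

section \<open>From residue densities to averages of periodic functions\<close>

lemma sum_of_bool_eq_1:
  "finite A \<Longrightarrow> x \<in> A \<Longrightarrow> (\<And>y. y \<in> A \<Longrightarrow> P y \<longleftrightarrow> y = x) \<Longrightarrow> (\<Sum>y\<in>A. of_bool (P y) * f y) = (f x :: real)"
  by (subst sum.remove[of _ x]) (auto intro!: sum.neutral)

lemma sum_residue_density:
  fixes f :: "nat \<Rightarrow> nat \<Rightarrow> real"
  assumes "Q > 0" "q > 0" "b > 0"
  shows "(\<Sum>u<Q. \<Sum>w<q. f u w * residue_density b Q q t (int u) (int w)) =
    (\<Sum>r<b ^ t. f (r mod Q) (digit_reverse b t r mod q)) / real (b ^ t)"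
proof -
  have eq: "[int r = int u] (mod int m) \<longleftrightarrow> u = r mod m" if "u < m" for r u m
    unfolding cong_int_iff using that by (auto simp: cong_def)
  have "(\<Sum>u<Q. \<Sum>w<q. f u w * residue_density b Q q t (int u) (int w)) =
    (\<Sum>u<Q. \<Sum>w<q. \<Sum>r<b ^ t. of_bool (u = r mod Q) * (of_bool (w = digit_reverse b t r mod q) * f u w)) / real (b ^ t)"
    unfolding residue_density_def sum_distrib_left sum_divide_distrib
    by (intro sum.cong refl) (simp add: eq of_bool_conj)
  also have "(\<Sum>u<Q. \<Sum>w<q. \<Sum>r<b ^ t. of_bool (u = r mod Q) * (of_bool (w = digit_reverse b t r mod q) * f u w)) =
      (\<Sum>u<Q. \<Sum>r<b ^ t. \<Sum>w<q. of_bool (u = r mod Q) * (of_bool (w = digit_reverse b t r mod q) * f u w))"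
    by (intro sum.cong refl sum.swap)
  also have "\<dots> = (\<Sum>r<b ^ t. \<Sum>u<Q. \<Sum>w<q. of_bool (u = r mod Q) * (of_bool (w = digit_reverse b t r mod q) * f u w))"
    by (rule sum.swap)
  also have "\<dots> = (\<Sum>r<b ^ t. f (r mod Q) (digit_reverse b t r mod q))"
  proof (intro sum.cong refl)
    fix r
    have "(\<Sum>u<Q. \<Sum>w<q. of_bool (u = r mod Q) * (of_bool (w = digit_reverse b t r mod q) * f u w)) =
      (\<Sum>u<Q. of_bool (u = r mod Q) * (\<Sum>w<q. of_bool (w = digit_reverse b t r mod q) * f u w))"
      by (simp only: sum_distrib_left)
    also have "\<dots> = f (r mod Q) (digit_reverse b t r mod q)"
      using assms by (simp add: sum_of_bool_eq_1[of "{..<Q}" "r mod Q"]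
          sum_of_bool_eq_1[of "{..<q}" "digit_reverse b t r mod q"])
    finally show "(\<Sum>u<Q. \<Sum>w<q. of_bool (u = r mod Q) * (of_bool (w = digit_reverse b t r mod q) * f u w)) =
      f (r mod Q) (digit_reverse b t r mod q)" .
  qed
  finally show ?thesis .
qed

text \<open>The densities sum to \<open>1\<close> over the \<open>Q * q\<close> pairs, so their mean
  lies between the bounds \<open>l\<close> and \<open>h\<close>, and \<open>h - l\<close> can be
  made smaller than \<open>e\<close>.\<close>

lemma residue_density_equidistributed:
  assumes b: "b \<ge> 2" and q: "q > 0" "coprime b q" "coprime (b * b - 1) q"
    and Q: "Q > 0" "coprime b Q" "q dvd Q" and e: "e > 0"
  obtains t where "\<And>u w. \<bar>residue_density b Q q t u w - 1 / (real Q * real q)\<bar> \<le> e"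
proof -
  obtain t where t: "[b ^ t = 1] (mod Q)" "[b ^ t = 1] (mod q)"
    "\<And>u w :: int. \<exists>r<b ^ t. [int r = u] (mod int Q) \<and> [int (digit_reverse b t r) = w] (mod int q)"
    using exists_covering_length[OF b q Q] by metis
  have "1 / real (b ^ t) > 0" "1 / real (b ^ t) \<le> 1" using b by auto
  then obtain k where k: "(1 - 1 / real (b ^ t)) ^ k < e"
    using real_arch_pow_inv[OF e, of "1 - 1 / real (b ^ t)"] by auto
  have "b > 0" using b by simp
  then obtain l h where lh: "\<And>u w. l \<le> residue_density b Q q (t * k) u w"
      "\<And>u w. residue_density b Q q (t * k) u w \<le> h" "h - l = (1 - 1 / real (b ^ t)) ^ k"
    using exists_density_bounds[OF _ t, of k] by blast
  have mean: "(\<Sum>u<Q. \<Sum>w<q. residue_density b Q q (t * k) (int u) (int w)) = 1"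
    using sum_residue_density[of Q q b "\<lambda>_ _. 1" "t * k"] Q q b by simp
  have "(\<Sum>u<Q. \<Sum>w<q. l) \<le> (\<Sum>u<Q. \<Sum>w<q. residue_density b Q q (t * k) (int u) (int w))"
    by (intro sum_mono lh)
  then have 1: "l \<le> 1 / (real Q * real q)" using mean Q q by (simp add: field_simps)
  have "(\<Sum>u<Q. \<Sum>w<q. residue_density b Q q (t * k) (int u) (int w)) \<le> (\<Sum>u<Q. \<Sum>w<q. h)"
    by (intro sum_mono lh)
  then have 2: "1 / (real Q * real q) \<le> h" using mean Q q by (simp add: field_simps)
  have "\<bar>residue_density b Q q (t * k) u w - 1 / (real Q * real q)\<bar> \<le> e" for u w
    using lh(1)[of u w] lh(2)[of u w] lh(3) 1 2 k by linarith
  then show thesis by (rule that)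
qed

lemma sum_affine_residues:
  fixes f :: "nat \<Rightarrow> 'a :: comm_monoid_add"
  assumes "coprime a Q" "Q > 0" "\<And>n. f (n mod Q) = f n"
  shows "(\<Sum>u<Q. f (e + a * u)) = (\<Sum>u<Q. f u)"
proof -
  have inj: "inj_on (\<lambda>u. (e + a * u) mod Q) {..<Q}"
  proof (rule inj_onI)
    fix x y assume "x \<in> {..<Q}" "y \<in> {..<Q}" "(e + a * x) mod Q = (e + a * y) mod Q"
    then have "[e + a * x = e + a * y] (mod Q)" by (simp add: cong_def)
    then have "[x = y] (mod Q)"
      using assms(1) by (simp add: cong_add_lcancel_nat cong_mult_lcancel_nat)
    then show "x = y" using \<open>x \<in> {..<Q}\<close> \<open>y \<in> {..<Q}\<close>
      by (auto intro: cong_less_modulus_unique_nat)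
  qed
  moreover have "(\<lambda>u. (e + a * u) mod Q) ` {..<Q} = {..<Q}"
    using assms(2) by (intro endo_inj_surj inj) auto
  ultimately have "bij_betw (\<lambda>u. (e + a * u) mod Q) {..<Q} {..<Q}" by (simp add: bij_betw_def)
  from sum.reindex_bij_betw[OF this, of f] show ?thesis by (simp add: assms(3))
qed

text \<open>The shifts \<open>x\<close>, \<open>y\<close> and factors \<open>a\<close>,
  \<open>d\<close> stand for the fixed digits around a free block. Affine maps with coprime factor
  permute the residues, so the averages do not depend on them, uniformly in the fixed
  digits.\<close>

lemma sum_affine_equidistributed:
  fixes f g :: "nat \<Rightarrow> real"
  assumes b: "b > 0" and Q: "Q > 0" "coprime a Q" and q: "q > 0" "coprime d q"
    and f: "\<And>n. f (n mod Q) = f n" "\<And>n. \<bar>f n\<bar> \<le> 1" and g: "\<And>n. g (n mod q) = g n" "\<And>n. \<bar>g n\<bar> \<le> 1"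
    and D: "\<And>u w. \<bar>residue_density b Q q t u w - 1 / (real Q * real q)\<bar> \<le> e / (real Q * real q)"
  shows "\<bar>(\<Sum>r<b ^ t. f (x + a * r) * g (y + d * digit_reverse b t r)) -
    real (b ^ t) * ((\<Sum>u<Q. f u) / real Q) * ((\<Sum>w<q. g w) / real q)\<bar> \<le> e * real (b ^ t)"
proof -
  define F where "F u w = f (x + a * u) * g (y + d * w)" for u w
  have F: "F (u mod Q) (w mod q) = F u w" for u w
  proof -
    have "(x + a * (u mod m)) mod m = (x + a * u) mod m" for x a u m :: nat
      by (metis mod_add_right_eq mod_mult_right_eq)
    then show ?thesis unfolding F_def by (metis f(1) g(1))
  qed
  have F1: "\<bar>F u w\<bar> \<le> 1" for u w
    unfolding F_def abs_mult using mult_mono[OF f(2) g(2)] by simp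
  have "(\<Sum>u<Q. \<Sum>w<q. F u w) = (\<Sum>u<Q. f (x + a * u)) * (\<Sum>w<q. g (y + d * w))"
    by (simp add: F_def sum_product)
  also have "\<dots> = (\<Sum>u<Q. f u) * (\<Sum>w<q. g w)"
    using assms by (simp add: sum_affine_residues)
  finally have main: "(\<Sum>u<Q. \<Sum>w<q. F u w * (1 / (real Q * real q))) = ((\<Sum>u<Q. f u) / real Q) * ((\<Sum>w<q. g w) / real q)"
    by (simp flip: sum_divide_distrib)
  have "(\<Sum>r<b ^ t. F r (digit_reverse b t r)) / real (b ^ t) =
      (\<Sum>u<Q. \<Sum>w<q. F u w * residue_density b Q q t (int u) (int w))"
    using Q q b by (subst sum_residue_density) (auto simp: F)
  then have "(\<Sum>r<b ^ t. F r (digit_reverse b t r)) / real (b ^ t) -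
      ((\<Sum>u<Q. f u) / real Q) * ((\<Sum>w<q. g w) / real q) =
      (\<Sum>u<Q. \<Sum>w<q. F u w * (residue_density b Q q t (int u) (int w) - 1 / (real Q * real q)))"
    unfolding main[symmetric] by (simp only: right_diff_distrib sum_subtractf)
  also have "\<bar>\<dots>\<bar> \<le> (\<Sum>u<Q. \<Sum>w<q. 1 * (e / (real Q * real q)))"
    by (intro order_trans[OF sum_abs] sum_mono) (unfold abs_mult, intro mult_mono F1 D, auto)
  also have "\<dots> = e" using Q q by simp
  finally have *: "\<bar>(\<Sum>r<b ^ t. F r (digit_reverse b t r)) / real (b ^ t) -
      ((\<Sum>u<Q. f u) / real Q) * ((\<Sum>w<q. g w) / real q)\<bar> \<le> e" .
  define N where "N = real (b ^ t)"
  have N: "N > 0" using b by (simp add: N_def)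
  have "\<bar>(\<Sum>r<b ^ t. F r (digit_reverse b t r)) - N * (((\<Sum>u<Q. f u) / real Q) * ((\<Sum>w<q. g w) / real q))\<bar> =
    N * \<bar>(\<Sum>r<b ^ t. F r (digit_reverse b t r)) / N - ((\<Sum>u<Q. f u) / real Q) * ((\<Sum>w<q. g w) / real q)\<bar>"
    using N by (simp add: abs_mult_pos' right_diff_distrib)
  also have "\<dots> \<le> N * e" using * N unfolding N_def by (intro mult_left_mono) auto
  finally show ?thesis by (simp add: F_def N_def mult_ac)
qed

section \<open>Equidistribution in residue classes within \<open>H b\<close>\<close>

text \<open>The Chinese remainder theorem, in the form that periodic functions with coprime periods
  are independent.\<close>

lemma sum_mult_coprime_moduli:
  fixes f g :: "nat \<Rightarrow> real"
  assumes "coprime m n" "m > 0" "n > 0"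
    and f: "\<And>u. f (u mod m) = f u" and g: "\<And>u. g (u mod n) = g u"
  shows "(\<Sum>u<m * n. f u * g u) = (\<Sum>u<m. f u) * (\<Sum>v<n. g v)"
proof -
  let ?h = "\<lambda>u. (u mod m, u mod n)"
  have inj: "inj_on ?h {..<m * n}"
  proof (rule inj_onI)
    fix x y assume xy: "x \<in> {..<m * n}" "y \<in> {..<m * n}" "?h x = ?h y"
    then have "[x = y] (mod m * n)"
      using assms(1) by (intro coprime_cong_mult_nat) (auto simp: cong_def)
    with xy show "x = y" by (auto intro: cong_less_modulus_unique_nat)
  qed
  have "?h ` {..<m * n} = {..<m} \<times> {..<n}"
    using inj assms by (intro card_seteq) (auto simp: card_image)
  then have "bij_betw ?h {..<m * n} ({..<m} \<times> {..<n})"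
    using inj by (simp add: bij_betw_def)
  from sum.reindex_bij_betw[OF this, of "\<lambda>x. f (fst x) * g (snd x)"]
  have "(\<Sum>u<m * n. f u * g u) = (\<Sum>x\<in>{..<m} \<times> {..<n}. f (fst x) * g (snd x))"
    by (simp only: fst_conv snd_conv f g)
  also have "\<dots> = (\<Sum>u<m. \<Sum>v<n. f u * g v)"
    unfolding sum.cartesian_product by (simp only: split_def)
  also have "\<dots> = (\<Sum>u<m. f u) * (\<Sum>v<n. g v)"
    by (rule sum_product[symmetric])
  finally show ?thesis .
qed

lemma coprime_cong_iff: "[a = c] (mod m) \<Longrightarrow> coprime a m \<longleftrightarrow> coprime c m" for a c m :: nat
  using cong_gcd_eq[of a c m] by (simp only: coprime_iff_gcd_eq_1)

text \<open>Here \<open>c\<close> is the last digit, \<open>r\<close> a free middle block and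
  \<open>m\<close> the leading part. The conditions modulo \<open>b\<close> involve only
  \<open>c\<close> and \<open>m\<close>, so \<open>r\<close> matters only modulo
  \<open>b * b - 1\<close>, and the reverse of \<open>n\<close> is affine in the reverse of
  \<open>r\<close>.\<close>

lemma mem_H_append_iff:
  assumes b: "b \<ge> 2" and "c < b" "r < b ^ t" "m > 0"
  defines "n \<equiv> c + b * r + b ^ Suc t * m"
  shows "reverse_base b n =
      (b ^ floorlog b m * (c * b ^ t) + reverse_base b m) + b ^ floorlog b m * digit_reverse b t r"
    and "n \<in> H b \<longleftrightarrow> coprime c b \<and> coprime (reverse_base b m) b \<and> coprime n (b * b - 1)"
proof -
  have "c + b * r < b * Suc r" using assms by simp
  also have "\<dots> \<le> b * b ^ t" using assms by (intro mult_left_mono) auto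
  finally have "c + b * r < b ^ Suc t" by simp
  then show *: "reverse_base b n =
      (b ^ floorlog b m * (c * b ^ t) + reverse_base b m) + b ^ floorlog b m * digit_reverse b t r"
    unfolding n_def using assms by (subst reverse_base_append) (auto simp: algebra_simps)
  have "floorlog b m > 0" using assms floorlog_eq_zero_iff[of b m] by auto
  then obtain k where k: "floorlog b m = Suc k" by (cases "floorlog b m") auto
  have "reverse_base b n = b * (b ^ k * (c * b ^ t + digit_reverse b t r)) + reverse_base b m"
    unfolding * k by (simp add: algebra_simps)
  then have "[reverse_base b n = reverse_base b m] (mod b)" by (simp add: cong_def)
  moreover have "n = b * (r + b ^ t * m) + c" by (simp add: n_def algebra_simps)
  then have "[n = c] (mod b)" by (simp add: cong_def)
  moreover have "n > 0" using assms by (auto simp: n_def)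
  ultimately show "n \<in> H b \<longleftrightarrow> coprime c b \<and> coprime (reverse_base b m) b \<and> coprime n (b * b - 1)"
    using coprime_cong_iff mem_H_iff[OF b] by blast
qed

section \<open>Averages of periodic conditions\<close>

definition residue_average :: "nat \<Rightarrow> (nat \<Rightarrow> bool) \<Rightarrow> real" where
  "residue_average q A = (\<Sum>u<q. of_bool (A u)) / real q"

lemma residue_average_nonneg: "residue_average q A \<ge> 0"
  by (auto simp: residue_average_def intro!: divide_nonneg_nonneg sum_nonneg)

lemma residue_average_le_1: "residue_average q A \<le> 1"
proof -
  have "(\<Sum>u<q. of_bool (A u)) \<le> (\<Sum>u<q. 1 :: real)" by (intro sum_mono) auto
  then show ?thesis by (auto simp: residue_average_def divide_le_eq)
qed

lemma residue_average_True: "q > 0 \<Longrightarrow> residue_average q (\<lambda>_. True) = 1"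
  by (simp add: residue_average_def)

lemma residue_average_conj:
  assumes "coprime m n" "m > 0" "n > 0" "\<And>u. A (u mod m) = A u" "\<And>u. B (u mod n) = B u"
  shows "residue_average (m * n) (\<lambda>u. A u \<and> B u) = residue_average m A * residue_average n B"
  using sum_mult_coprime_moduli[of m n "\<lambda>u. of_bool (A u)" "\<lambda>u. of_bool (B u)"] assms
  unfolding residue_average_def by (simp only: of_bool_conj) simp

text \<open>For fixed leading part \<open>m\<close> and last digit \<open>c\<close>, the middle
  digits equidistribute the residue pair. Being coprime to \<open>b * b - 1\<close> is independent
  of \<open>A\<close> because \<open>q\<close> is coprime to \<open>b * b - 1\<close>. The block
  length \<open>W\<close> is the same for all \<open>m\<close>.\<close>

lemma exists_block_length:
  assumes b: "b \<ge> 2" and q: "q > 0" "coprime b q" "coprime (b * b - 1) q" and e: "e > 0"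
    and A: "\<And>u. A (u mod q) = A u" and B: "\<And>u. B (u mod q) = B u"
  obtains W where "W > 0"
    "\<And>m. m > 0 \<Longrightarrow> \<bar>\<Sum>n<W. of_bool (n + W * m \<in> H b) *
        (of_bool (A (n + W * m) \<and> B (reverse_base b (n + W * m))) - residue_average q A * residue_average q B)\<bar>
      \<le> e * real W"
proof -
  define M where "M = b * b - 1"
  define Q where "Q = M * q"
  have "b * b \<ge> 2 * 2" using b by (intro mult_mono) auto
  then have M: "M > 0" "coprime b M" using coprime_base[of b] b by (auto simp: M_def)
  have Q: "Q > 0" "coprime b Q" "q dvd Q" using M q by (auto simp: Q_def)
  \<comment> \<open>Half of the error is spent on the conditions \<open>A\<close>, \<open>B\<close>
    and half on the trivial conditions, to which they are compared.\<close>
  have "e / 2 / (real Q * real q) > 0" using e Q q by simp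
  then obtain t where t: "\<And>u w. \<bar>residue_density b Q q t u w - 1 / (real Q * real q)\<bar> \<le> e / 2 / (real Q * real q)"
    using residue_density_equidistributed[OF b q Q] by metis
  define W where "W = b ^ Suc t"
  show thesis
  proof (rule that[of W])
    show "W > 0" using b by (simp add: W_def)
    fix m :: nat
    assume m: "m > 0"
    define K where "K = (\<Sum>c<b. of_bool (coprime c b \<and> coprime (reverse_base b m) b) :: real)"
    have K: "0 \<le> K" "K * real (b ^ t) \<le> real W"
    proof -
      show "0 \<le> K" unfolding K_def by (intro sum_nonneg) auto
      have "K \<le> (\<Sum>c<b. 1)" unfolding K_def by (intro sum_mono) auto
      then show "K * real (b ^ t) \<le> real W" using b by (simp add: W_def mult_right_mono)
    qed
    define mu where "mu = real (b ^ t) * residue_average M (\<lambda>u. coprime u M)"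
    define S where "S A B = (\<Sum>n<W. of_bool (n + W * m \<in> H b) *
      of_bool (A (n + W * m) \<and> B (reverse_base b (n + W * m))) :: real)" for A B :: "nat \<Rightarrow> bool"
    \<comment> \<open>Stated for arbitrary periodic conditions, since it is applied both to
      \<open>A\<close>, \<open>B\<close> and to the always true ones; the latter count
      \<open>H b\<close> itself in the block.\<close>
    have S: "\<bar>S A B - K * (mu * residue_average q A * residue_average q B)\<bar> \<le> e / 2 * real W"
      if A: "\<And>u. A (u mod q) = A u" and B: "\<And>u. B (u mod q) = B u" for A B
    proof -
      define f where "f u = (of_bool (coprime u M \<and> A u) :: real)" for u
      define g where "g u = (of_bool (B u) :: real)" for u
      define L where "L = b ^ floorlog b m"
      define G where "G c = (\<Sum>r<b ^ t. f ((c + W * m) + b * r) *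
          g ((L * (c * b ^ t) + reverse_base b m) + L * digit_reverse b t r))" for c
      have f_periodic: "f (n mod Q) = f n" for n
      proof -
        have "A (n mod Q) = A n" using A[of "n mod Q"] A[of n] Q(3) by (simp add: mod_mod_cancel)
        moreover have "[n mod Q = n] (mod M)" by (simp add: Q_def cong_def mod_mod_cancel)
        ultimately show ?thesis unfolding f_def by (simp add: coprime_cong_iff[of "n mod Q" n])
      qed
      have "coprime L q" using q(2) by (simp add: L_def)
      then have G: "\<bar>G c - real (b ^ t) * ((\<Sum>u<Q. f u) / real Q) * ((\<Sum>w<q. g w) / real q)\<bar> \<le> e / 2 * real (b ^ t)" for c
        unfolding G_def using b Q q t B
        by (intro sum_affine_equidistributed f_periodic) (auto simp: f_def g_def)
      have "(\<Sum>w<q. g w) / real q = residue_average q B"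
        by (simp add: g_def residue_average_def)
      moreover have "(\<Sum>u<Q. f u) / real Q = residue_average Q (\<lambda>u. coprime u M \<and> A u)"
        by (simp add: f_def residue_average_def)
      moreover have "\<dots> = residue_average M (\<lambda>u. coprime u M) * residue_average q A"
        unfolding Q_def using M q A by (intro residue_average_conj) (auto simp: M_def)
      ultimately have G: "\<bar>G c - mu * residue_average q A * residue_average q B\<bar> \<le> e / 2 * real (b ^ t)" for c
        using G[of c] by (simp add: mu_def mult_ac)
      have "S A B = (\<Sum>r<b ^ t. \<Sum>c<b. of_bool (coprime c b \<and> coprime (reverse_base b m) b) *
          (f ((c + W * m) + b * r) * g ((L * (c * b ^ t) + reverse_base b m) + L * digit_reverse b t r)))"
        unfolding S_def W_def power_Suc sum_lessThan_mult
      proof (intro sum.cong refl)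
        fix r c assume rc: "r \<in> {..<b ^ t}" "c \<in> {..<b}"
        have n: "c + b * b ^ t * m + b * r = c + b * r + b ^ Suc t * m" by simp
        show "of_bool (c + b * r + b * b ^ t * m \<in> H b) *
            of_bool (A (c + b * r + b * b ^ t * m) \<and> B (reverse_base b (c + b * r + b * b ^ t * m))) =
          of_bool (coprime c b \<and> coprime (reverse_base b m) b) * (f (c + b * b ^ t * m + b * r) *
            g (L * (c * b ^ t) + reverse_base b m + L * digit_reverse b t r))"
          unfolding n L_def
          using mem_H_append_iff[OF b, of c r t m] rc m
          by (simp add: f_def g_def M_def flip: of_bool_conj)
      qed
      also have "\<dots> = (\<Sum>c<b. \<Sum>r<b ^ t. of_bool (coprime c b \<and> coprime (reverse_base b m) b) *
          (f ((c + W * m) + b * r) * g ((L * (c * b ^ t) + reverse_base b m) + L * digit_reverse b t r)))"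
        by (rule sum.swap)
      finally have SG: "S A B = (\<Sum>c<b. of_bool (coprime c b \<and> coprime (reverse_base b m) b) * G c)"
        unfolding G_def by (simp only: sum_distrib_left)
      have "\<bar>S A B - K * (mu * residue_average q A * residue_average q B)\<bar> =
          \<bar>\<Sum>c<b. of_bool (coprime c b \<and> coprime (reverse_base b m) b) *
            (G c - mu * residue_average q A * residue_average q B)\<bar>"
        unfolding SG K_def sum_distrib_right right_diff_distrib sum_subtractf ..
      also have "\<dots> \<le> (\<Sum>c<b. of_bool (coprime c b \<and> coprime (reverse_base b m) b) * (e / 2 * real (b ^ t)))"
        by (intro order_trans[OF sum_abs] sum_mono) (use G in \<open>auto simp: abs_mult\<close>)
      also have "\<dots> = e / 2 * (K * real (b ^ t))"
        unfolding K_def sum_distrib_right sum_distrib_left by (intro sum.cong) auto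
      also have "\<dots> \<le> e / 2 * real W" using K e by (intro mult_left_mono) auto
      finally show ?thesis .
    qed
    define rho where "rho = residue_average q A * residue_average q B"
    have rho: "0 \<le> rho" "rho \<le> 1"
      using residue_average_nonneg[of q] residue_average_le_1[of q]
      by (auto simp: rho_def intro!: mult_nonneg_nonneg mult_le_one)
    have 1: "\<bar>S A B - rho * (K * mu)\<bar> \<le> e / 2 * real W"
      using S[of A B, OF A B] by (simp add: rho_def mult_ac)
    have "\<bar>S (\<lambda>_. True) (\<lambda>_. True) - K * mu\<bar> \<le> e / 2 * real W"
      using S[of "\<lambda>_. True" "\<lambda>_. True"] q by (simp add: residue_average_True)
    then have "rho * \<bar>S (\<lambda>_. True) (\<lambda>_. True) - K * mu\<bar> \<le> 1 * (e / 2 * real W)"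
      using rho by (intro mult_mono) auto
    then have 2: "\<bar>rho * S (\<lambda>_. True) (\<lambda>_. True) - rho * (K * mu)\<bar> \<le> e / 2 * real W"
      using rho by (simp add: abs_mult flip: right_diff_distrib)
    \<comment> \<open>The main term \<open>rho * (K * mu)\<close> is common to both counts and
      cancels.\<close>
    have "(\<Sum>n<W. of_bool (n + W * m \<in> H b) *
        (of_bool (A (n + W * m) \<and> B (reverse_base b (n + W * m))) - rho)) = S A B - rho * S (\<lambda>_. True) (\<lambda>_. True)"
      by (simp add: S_def right_diff_distrib sum_subtractf sum_distrib_left mult.commute)
    also have "\<bar>\<dots>\<bar> \<le> e * real W" using 1 2 by linarith
    finally show "\<bar>\<Sum>n<W. of_bool (n + W * m \<in> H b) *
        (of_bool (A (n + W * m) \<and> B (reverse_base b (n + W * m))) - residue_average q A * residue_average q B)\<bar>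
      \<le> e * real W"
      unfolding rho_def .
  qed
qed

text \<open>The block \<open>m = 0\<close>, whose elements have varying numbers of digits in the
  application, and the incomplete last block are estimated trivially by \<open>W\<close>
  each.\<close>

lemma abs_sum_le_of_blocks:
  fixes f :: "nat \<Rightarrow> real"
  assumes "W > 0" "e \<ge> 0" "\<And>n. \<bar>f n\<bar> \<le> 1" "\<And>m. m > 0 \<Longrightarrow> \<bar>\<Sum>n<W. f (n + W * m)\<bar> \<le> e * real W"
  shows "\<bar>\<Sum>n<N. f n\<bar> \<le> e * real N + 2 * real W"
proof -
  define k where "k = N div W"
  have k: "W * k \<le> N" "N \<le> W * k + W"
    using div_mult_mod_eq[of N W] mod_less_divisor[OF assms(1), of N]
    unfolding k_def mult.commute[of W] by linarith+
  have "{..<N} = {..<W * k} \<union> {W * k..<N}" using k by auto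
  then have "(\<Sum>n<N. f n) = (\<Sum>n<W * k. f n) + (\<Sum>n\<in>{W * k..<N}. f n)"
    by (simp add: sum.union_disjoint ivl_disj_int)
  moreover have "\<bar>\<Sum>n\<in>{W * k..<N}. f n\<bar> \<le> real W"
  proof -
    have "\<bar>\<Sum>n\<in>{W * k..<N}. f n\<bar> \<le> (\<Sum>n\<in>{W * k..<N}. 1)"
      by (intro order_trans[OF sum_abs] sum_mono assms)
    also have "\<dots> = real (N - W * k)" by simp
    also have "\<dots> \<le> real W" using k by (intro of_nat_mono) linarith
    finally show ?thesis .
  qed
  moreover have "\<bar>\<Sum>n<W * k. f n\<bar> \<le> e * real N + real W"
  proof -
    have "\<bar>\<Sum>n<W * k. f n\<bar> \<le> (\<Sum>m<k. \<bar>\<Sum>n<W. f (n + W * m)\<bar>)"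
      unfolding sum_lessThan_mult by (rule sum_abs)
    also have "\<dots> \<le> (\<Sum>m<k. e * real W + (if m = 0 then real W else 0))"
    proof (intro sum_mono)
      fix m
      have "\<bar>\<Sum>n<W. f (n + W * m)\<bar> \<le> (\<Sum>n<W. 1)"
        by (intro order_trans[OF sum_abs] sum_mono assms)
      then show "\<bar>\<Sum>n<W. f (n + W * m)\<bar> \<le> e * real W + (if m = 0 then real W else 0)"
        using assms(4)[of m] assms(2) by (cases "m = 0") (auto intro: add_increasing)
    qed
    also have "\<dots> \<le> e * real (W * k) + real W"
      by (simp add: sum.distrib sum.delta mult_ac)
    also have "\<dots> \<le> e * real N + real W"
      using k(1) assms(2) by (intro add_right_mono mult_left_mono) (simp_all del: of_nat_mult)
    finally show ?thesis .
  qed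
  ultimately show ?thesis by linarith
qed

lemma H_equidistributed:
  assumes b: "b \<ge> 2" and q: "q > 0" "coprime b q" "coprime (b * b - 1) q" and e: "e > 0"
    and A: "\<And>u. A (u mod q) = A u" and B: "\<And>u. B (u mod q) = B u"
  obtains C where "\<And>N. \<bar>(\<Sum>n<N. of_bool (n \<in> H b \<and> A n \<and> B (reverse_base b n))) -
    residue_average q A * residue_average q B * (\<Sum>n<N. of_bool (n \<in> H b))\<bar> \<le> e * real N + C"
proof -
  obtain W where W: "W > 0"
    "\<And>m. m > 0 \<Longrightarrow> \<bar>\<Sum>n<W. of_bool (n + W * m \<in> H b) *
        (of_bool (A (n + W * m) \<and> B (reverse_base b (n + W * m))) - residue_average q A * residue_average q B)\<bar>
      \<le> e * real W"
    by (rule exists_block_length[of b q e A B, OF b q e A B]) (rule that)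
  define rho where "rho = residue_average q A * residue_average q B"
  have rho: "0 \<le> rho" "rho \<le> 1"
    using residue_average_nonneg[of q] residue_average_le_1[of q]
    by (auto simp: rho_def intro!: mult_nonneg_nonneg mult_le_one)
  have "\<bar>\<Sum>n<N. of_bool (n \<in> H b) * (of_bool (A n \<and> B (reverse_base b n)) - rho)\<bar> \<le> e * real N + 2 * real W" for N
  proof (rule abs_sum_le_of_blocks[OF W(1)])
    show "\<bar>of_bool (n \<in> H b) * (of_bool (A n \<and> B (reverse_base b n)) - rho)\<bar> \<le> 1" for n
      using rho by (auto simp: abs_mult of_bool_def)
  qed (use W(2) e rho_def in auto)
  then show thesis
    by (intro that[of "2 * real W"])
       (simp add: rho_def right_diff_distrib sum_subtractf sum_distrib_left mult.commute of_bool_conj)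
qed

section \<open>Lower density and large square divisors\<close>

lemma sum_of_bool_eq_card: "(\<Sum>n<N. of_bool (P n)) = real (card {n. n < N \<and> P n})" for N :: nat
proof -
  have "{..<N} \<inter> {n. P n} = {n. n < N \<and> P n}" by auto
  then show ?thesis by simp
qed

text \<open>The range forces leading digit \<open>1\<close>, hence the reverse is \<open>1\<close>
  modulo \<open>b\<close>; the congruence settles the conditions on \<open>n\<close>.\<close>

lemma H_leading_digit_1:
  assumes b: "b \<ge> 2" and n: "b ^ l \<le> n" "n < 2 * b ^ l" "[n = 1] (mod b * (b * b - 1))"
  shows "n \<in> H b"
proof -
  obtain r where r: "n = r + b ^ l * 1" "r < b ^ l"
    using n by (metis add.commute le_add_diff_inverse2 mult.right_neutral mult_2 nat_add_left_cancel_less le_add_diff_inverse)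
  have "floorlog b 1 = 1"
    using b compute_floorlog[of b 1] floorlog_eq_zero_iff[of b "1 div b"] by simp
  then have "reverse_base b n = 1 + b * digit_reverse b l r"
    unfolding r(1) using b r(2) by (subst reverse_base_append) (auto simp: reverse_base_eq_digit_reverse)
  then have "coprime (reverse_base b n) b"
    using coprime_cong_iff[of "reverse_base b n" 1 b] by (simp add: cong_add_lcancel_0_nat cong_0_iff del: One_nat_def)
  moreover have "coprime n b" "coprime n (b * b - 1)"
    using coprime_cong_iff[OF n(3)] by simp_all
  ultimately show ?thesis
    using b r by (simp add: mem_H_iff)
qed

text \<open>\<open>H b\<close> contains the progression \<open>1\<close> modulo \<open>R\<close>
  within \<open>[b^l, 2 b^l)\<close>, where \<open>b^l\<close> is the largest power of
  \<open>b\<close> not exceeding \<open>N div 2\<close>. This interval lies below \<open>N\<close>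
  and is comparable to \<open>N\<close> in length.\<close>

lemma H_count_lower_bound:
  assumes b: "b \<ge> 2"
  obtains c N0 where "c > 0" "\<And>N. N \<ge> N0 \<Longrightarrow> c * real N \<le> (\<Sum>n<N. of_bool (n \<in> H b))"
proof -
  define R where "R = b * (b * b - 1)"
  have "b * b \<ge> 2 * 2" using b by (intro mult_mono) auto
  then have R: "R > 0" using b by (simp add: R_def)
  show thesis
  proof (rule that[of "1 / (8 * real b * real R)" "8 * b * R"])
    show "1 / (8 * real b * real R) > 0" using b R by simp
    fix N assume N: "N \<ge> 8 * b * R"
    have "b * R \<ge> 1" using b R by (simp add: Suc_le_eq)
    then have "N \<ge> 2" using N unfolding mult.assoc by linarith
    then have pos: "N div 2 > 0" by (simp add: div_greater_zero_iff)
    define l where "l = floorlog b (N div 2) - 1"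
    have "floorlog b (N div 2) > 0" using pos b floorlog_eq_zero_iff[of b "N div 2"] by auto
    then have l: "b ^ l \<le> N div 2" "N div 2 < b * b ^ l"
      using floorlog_bounds[OF pos, of b] b by (auto simp: l_def simp flip: power_Suc)
    define k where "k = b ^ l div R"
    \<comment> \<open>The least shift that takes \<open>b^l\<close> into the class of
      \<open>1\<close> modulo \<open>R\<close>.\<close>
    define d where "d = nat ((1 - int (b ^ l)) mod int R)"
    have d: "d < R" "[int (b ^ l + d) = 1] (mod int R)"
    proof -
      show "d < R" using R by (simp add: d_def nat_less_iff)
      have "[int d = 1 - int (b ^ l)] (mod int R)" using R by (simp add: d_def cong_def)
      then have "[int (b ^ l) + int d = int (b ^ l) + (1 - int (b ^ l))] (mod int R)"
        by (intro cong_add cong_refl)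
      then show "[int (b ^ l + d) = 1] (mod int R)" by simp
    qed
    have "(\<lambda>j. b ^ l + d + R * j) ` {..<k} \<subseteq> {n. n < N \<and> n \<in> H b}"
    proof safe
      fix j assume j: "j < k"
      have "d + R * j < R * Suc j" using d(1) by simp
      also have "\<dots> \<le> R * k" using j by (intro mult_left_mono) auto
      also have "\<dots> \<le> b ^ l" by (simp add: k_def)
      finally have less: "b ^ l + d + R * j < 2 * b ^ l" by simp
      then show "b ^ l + d + R * j < N" using l(1) by linarith
      have "[b ^ l + d = 1] (mod R)" using d(2) by (metis cong_int_iff of_nat_1)
      moreover have "[R * j = 0] (mod R)" by (simp add: cong_0_iff)
      ultimately have "[b ^ l + d + R * j = 1 + 0] (mod R)" by (rule cong_add)
      then have "[b ^ l + d + R * j = 1] (mod R)" by simp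
      with less show "b ^ l + d + R * j \<in> H b"
        unfolding R_def by (intro H_leading_digit_1[OF b, of l]) auto
    qed
    then have "card ((\<lambda>j. b ^ l + d + R * j) ` {..<k}) \<le> card {n. n < N \<and> n \<in> H b}"
      by (intro card_mono) auto
    moreover have "card ((\<lambda>j. b ^ l + d + R * j) ` {..<k}) = k"
      using R by (subst card_image) (auto simp: inj_on_def)
    ultimately have k: "real k \<le> (\<Sum>n<N. of_bool (n \<in> H b))"
      unfolding sum_of_bool_eq_card by simp
    have "b ^ l < R * k + R"
      using R div_mult_mod_eq[of "b ^ l" R] mod_less_divisor[OF R, of "b ^ l"] unfolding k_def
      by (simp only: mult.commute[of R])
    then have "2 * b * b ^ l \<le> 2 * b * (R * k + R)" by (intro mult_left_mono) auto
    moreover have "N \<le> 2 * b * b ^ l" using l(2) by simp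
    ultimately have "N \<le> 2 * b * (R * k) + 2 * b * R" by (simp add: algebra_simps)
    \<comment> \<open>The rounding loss \<open>2 * b * R\<close> is at most a quarter of
      \<open>N\<close>, because \<open>N >= 8 * b * R\<close>.\<close>
    then have "N \<le> 8 * b * R * k" using N by simp
    then have "real N \<le> real (8 * b * R * k)" by (rule of_nat_mono)
    then have "1 / (8 * real b * real R) * real N \<le> real k"
      using b R by (simp add: field_simps)
    with k show "1 / (8 * real b * real R) * real N \<le> (\<Sum>n<N. of_bool (n \<in> H b))" by linarith
  qed
qed

section \<open>Integers divisible by a large square\<close>

lemma sum_inverse_squares_tail:
  assumes "P > 0"
  shows "(\<Sum>d\<in>{P<..N}. 1 / (real d)\<^sup>2) \<le> 1 / real P"
proof (cases "P \<le> N")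
  case True
  then have "(\<Sum>d\<in>{P<..N}. 1 / (real d)\<^sup>2) \<le> 1 / real P - 1 / real N"
  proof (induction N rule: dec_induct)
    case (step N)
    have N: "real N > 0" using step assms by simp
    have "{P<..Suc N} = insert (Suc N) {P<..N}" using step by auto
    then have "(\<Sum>d\<in>{P<..Suc N}. 1 / (real d)\<^sup>2) \<le> 1 / (real N + 1)\<^sup>2 + (1 / real P - 1 / real N)"
      using step.IH by (simp add: add.commute)
    also have "1 / (real N + 1)\<^sup>2 \<le> 1 / real N - 1 / (real N + 1)"
      using N by (simp add: divide_simps power2_eq_square)
    finally show ?case by (simp add: add.commute)
  qed simp
  also have "\<dots> \<le> 1 / real P" by simp
  finally show ?thesis .
qed simp

lemma card_multiples_le: "card {n. 0 < n \<and> n \<le> N \<and> m dvd n} \<le> N div m" if "m > 0" for m N :: nat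
proof -
  have "{n. 0 < n \<and> n \<le> N \<and> m dvd n} \<subseteq> (\<lambda>k. m * k) ` {1..N div m}"
  proof
    fix n assume "n \<in> {n. 0 < n \<and> n \<le> N \<and> m dvd n}"
    then obtain k where "n = m * k" "0 < m * k" "m * k \<le> N" by auto
    then show "n \<in> (\<lambda>k. m * k) ` {1..N div m}" unfolding \<open>n = m * k\<close>
      using that by (intro imageI) (auto simp: less_eq_div_iff_mult_less_eq Suc_le_eq mult.commute)
  qed
  from surj_card_le[OF _ this] show ?thesis by simp
qed

lemma card_large_square_divisor_le:
  assumes "P > 0"
  shows "real (card {n. 0 < n \<and> n \<le> N \<and> (\<exists>d>P. d\<^sup>2 dvd n)}) \<le> real N / real P"
proof -
  have "{n. 0 < n \<and> n \<le> N \<and> (\<exists>d>P. d\<^sup>2 dvd n)} \<subseteq> (\<Union>d\<in>{P<..N}. {n. 0 < n \<and> n \<le> N \<and> d\<^sup>2 dvd n})"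
  proof safe
    fix n d assume nd: "0 < n" "n \<le> N" "d > P" "d\<^sup>2 dvd n"
    have "d \<le> d\<^sup>2" by (simp add: power2_eq_square)
    also have "d\<^sup>2 \<le> n" using nd by (intro dvd_imp_le)
    finally show "n \<in> (\<Union>d\<in>{P<..N}. {n. 0 < n \<and> n \<le> N \<and> d\<^sup>2 dvd n})" using nd by auto
  qed
  then have "card {n. 0 < n \<and> n \<le> N \<and> (\<exists>d>P. d\<^sup>2 dvd n)} \<le> card (\<Union>d\<in>{P<..N}. {n. 0 < n \<and> n \<le> N \<and> d\<^sup>2 dvd n})"
    by (intro card_mono) auto
  also have "\<dots> \<le> (\<Sum>d\<in>{P<..N}. card {n. 0 < n \<and> n \<le> N \<and> d\<^sup>2 dvd n})"
    by (rule card_UN_le) simp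
  finally have "real (card {n. 0 < n \<and> n \<le> N \<and> (\<exists>d>P. d\<^sup>2 dvd n)}) \<le>
      (\<Sum>d\<in>{P<..N}. real (card {n. 0 < n \<and> n \<le> N \<and> d\<^sup>2 dvd n}))"
    unfolding of_nat_sum[symmetric] by (rule of_nat_mono)
  also have "\<dots> \<le> (\<Sum>d\<in>{P<..N}. real N * (1 / (real d)\<^sup>2))"
  proof (rule sum_mono)
    fix d assume "d \<in> {P<..N}"
    then have "real (card {n. 0 < n \<and> n \<le> N \<and> d\<^sup>2 dvd n}) \<le> real (N div d\<^sup>2)"
      by (intro of_nat_mono card_multiples_le) auto
    also have "\<dots> \<le> real N * (1 / (real d)\<^sup>2)" using of_nat_div_le_of_nat[of N "d\<^sup>2", where 'a = real] by simp
    finally show "real (card {n. 0 < n \<and> n \<le> N \<and> d\<^sup>2 dvd n}) \<le> real N * (1 / (real d)\<^sup>2)" .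
  qed
  also have "\<dots> = real N * (\<Sum>d\<in>{P<..N}. 1 / (real d)\<^sup>2)" by (simp only: sum_distrib_left)
  also have "\<dots> \<le> real N * (1 / real P)"
    by (intro mult_left_mono sum_inverse_squares_tail assms) auto
  finally show ?thesis by simp
qed

text \<open>Elements of \<open>H b\<close> are not divisible by \<open>b\<close>, so reversal maps
  them injectively into the positive integers below \<open>b * N\<close>. The bound for ordinary
  integers thus applies once with \<open>N\<close> and once with \<open>b * N\<close>.\<close>

lemma card_H_large_square_divisor_le:
  assumes b: "b \<ge> 2" and P: "P > 0"
  shows "real (card {n. n < N \<and> n \<in> H b \<and> (\<exists>d>P. d\<^sup>2 dvd n \<or> d\<^sup>2 dvd reverse_base b n)}) \<le>
    (1 + real b) * real N / real P"
proof -
  define X where "X = {n. n < N \<and> n \<in> H b \<and> (\<exists>d>P. d\<^sup>2 dvd reverse_base b n)}"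
  define Y where "Y M = {n. 0 < n \<and> n \<le> M \<and> (\<exists>d>P. d\<^sup>2 dvd n)}" for M
  have H: "n > 0" "\<not> b dvd n" "reverse_base b n > 0" if "n \<in> H b" for n
  proof -
    show "n > 0" using that b by (simp add: mem_H_iff)
    show "\<not> b dvd n" using that b by (auto simp: mem_H_iff dest: coprime_common_divisor_nat[of n b b])
    show "reverse_base b n > 0" using that b by (cases "reverse_base b n") (auto simp: mem_H_iff)
  qed
  have fin: "finite X" "finite (Y M)" for M by (auto simp: X_def Y_def)
  have "card X = card (reverse_base b ` X)"
    by (rule card_image[symmetric], rule inj_on_subset[OF inj_on_reverse_base[OF b]]) (use H in \<open>auto simp: X_def\<close>)
  also have "\<dots> \<le> card (Y (b * N))"
  proof (intro card_mono fin subsetI)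
    fix m assume "m \<in> reverse_base b ` X"
    then obtain n where n: "m = reverse_base b n" "n < N" "n \<in> H b" "\<exists>d>P. d\<^sup>2 dvd m" by (auto simp: X_def)
    have "m < b * n" using reverse_base_less[OF b H(1)[OF n(3)]] n(1) by simp
    also have "\<dots> \<le> b * N" using n(2) by simp
    finally show "m \<in> Y (b * N)" using n H(3)[OF n(3)] by (auto simp: Y_def)
  qed
  finally have X: "real (card X) \<le> real (b * N) / real P"
    using card_large_square_divisor_le[OF P, of "b * N"] unfolding Y_def by linarith
  have "{n. n < N \<and> n \<in> H b \<and> (\<exists>d>P. d\<^sup>2 dvd n \<or> d\<^sup>2 dvd reverse_base b n)} \<subseteq> Y N \<union> X"
    using H(1) by (auto simp: X_def Y_def)
  then have "card {n. n < N \<and> n \<in> H b \<and> (\<exists>d>P. d\<^sup>2 dvd n \<or> d\<^sup>2 dvd reverse_base b n)} \<le> card (Y N \<union> X)"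
    using fin by (intro card_mono) auto
  also have "\<dots> \<le> card (Y N) + card X" by (rule card_Un_le)
  finally have "real (card {n. n < N \<and> n \<in> H b \<and> (\<exists>d>P. d\<^sup>2 dvd n \<or> d\<^sup>2 dvd reverse_base b n)}) \<le>
      real (card (Y N)) + real (card X)" unfolding of_nat_add[symmetric] by (rule of_nat_mono)
  also have "\<dots> \<le> real N / real P + real (b * N) / real P"
    using card_large_square_divisor_le[OF P, of N] X unfolding Y_def by (rule add_mono)
  also have "\<dots> = (1 + real b) * real N / real P" by (simp add: add_divide_distrib algebra_simps)
  finally show ?thesis .
qed

section \<open>The sieve by squares of primes\<close>

text \<open>Among the residues modulo \<open>p^2\<close> only \<open>0\<close> is excluded, and the
  moduli \<open>p^2\<close> are pairwise coprime.\<close>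

lemma residue_average_prime_squares:
  assumes "finite S" "\<And>p. p \<in> S \<Longrightarrow> prime p"
  shows "residue_average (\<Prod>p\<in>S. p\<^sup>2) (\<lambda>n. \<forall>p\<in>S. \<not> p\<^sup>2 dvd n) = (\<Prod>p\<in>S. 1 - 1 / (real p)\<^sup>2)"
  using assms
proof (induction S rule: finite_induct)
  case empty
  then show ?case by (simp add: residue_average_def)
next
  case (insert p S)
  define q where "q = (\<Prod>p\<in>S. p\<^sup>2)"
  have p: "p > 0" and S: "\<And>r. r \<in> S \<Longrightarrow> prime r" using insert by (auto simp: prime_gt_0_nat)
  have q: "q > 0" unfolding q_def using S by (intro prod_pos) (auto simp: prime_gt_0_nat)
  have "coprime p r" if "r \<in> S" for r
    using that insert by (intro primes_coprime) auto
  then have cop: "coprime (p\<^sup>2) q" unfolding q_def by (intro prod_coprime_right) simp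
  have "(\<Sum>u<p\<^sup>2. of_bool (\<not> p\<^sup>2 dvd u)) = (\<Sum>u<p\<^sup>2. 1 - of_bool (u = 0) :: real)"
    by (intro sum.cong refl) (auto dest: nat_dvd_not_less intro: gr0I)
  also have "\<dots> = real (p\<^sup>2) - (\<Sum>u<p\<^sup>2. of_bool (u = 0))" by (simp add: sum_subtractf)
  also have "(\<Sum>u<p\<^sup>2. of_bool (u = 0)) = (1 :: real)"
    using sum_of_bool_eq_1[of "{..<p\<^sup>2}" 0 "\<lambda>u. u = 0" "\<lambda>_. 1"] p by simp
  finally have *: "residue_average (p\<^sup>2) (\<lambda>n. \<not> p\<^sup>2 dvd n) = 1 - 1 / (real p)\<^sup>2"
    unfolding residue_average_def using p by (simp add: diff_divide_distrib)
  have "residue_average (p\<^sup>2 * q) (\<lambda>n. \<not> p\<^sup>2 dvd n \<and> (\<forall>p\<in>S. \<not> p\<^sup>2 dvd n)) =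
      residue_average (p\<^sup>2) (\<lambda>n. \<not> p\<^sup>2 dvd n) * residue_average q (\<lambda>n. \<forall>p\<in>S. \<not> p\<^sup>2 dvd n)"
  proof (rule residue_average_conj[OF cop _ q])
    fix u
    have "r\<^sup>2 dvd u mod q \<longleftrightarrow> r\<^sup>2 dvd u" if "r \<in> S" for r
      using that insert.hyps by (intro dvd_mod_iff) (auto simp: q_def intro: dvd_prodI)
    then show "(\<forall>p\<in>S. \<not> p\<^sup>2 dvd u mod q) = (\<forall>p\<in>S. \<not> p\<^sup>2 dvd u)" by auto
  qed (use p in \<open>auto simp: dvd_mod_iff\<close>)
  then show ?case
    using insert S * by (simp add: q_def)
qed

section \<open>The Euler product of \<open>zeta 2\<close>\<close>

lemma zeta_2_sums: "(\<lambda>n. 1 / (real (Suc n))\<^sup>2) sums zeta 2" and zeta_2_pos: "zeta 2 > 0"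
proof -
  have *: "(\<lambda>n. 1 / (real (Suc n))\<^sup>2) sums (pi\<^sup>2 / 6)"
    using inverse_squares_sums by (simp add: add.commute)
  then have "zeta 2 = pi\<^sup>2 / 6"
    by (simp add: zeta_def sums_iff)
  with * show "(\<lambda>n. 1 / (real (Suc n))\<^sup>2) sums zeta 2" "zeta 2 > 0" by (simp_all only:) simp
qed

text \<open>The sieve of Eratosthenes on \<open>\<zeta>(2)\<close>: removing the multiples of a further prime \<open>p\<close>
  multiplies the sum by \<open>1 - p\<^sup>-\<^sup>2\<close>.\<close>

lemma has_sum_inverse_squares_sieved:
  assumes "finite S" "\<And>p. p \<in> S \<Longrightarrow> prime p"
  shows "((\<lambda>n. 1 / (real n)\<^sup>2) has_sum (zeta 2 * (\<Prod>p\<in>S. 1 - 1 / (real p)\<^sup>2))) {n. n > 0 \<and> (\<forall>p\<in>S. \<not> p dvd n)}"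
  using assms
proof (induction S rule: finite_induct)
  case empty
  have "((\<lambda>n. 1 / (real (Suc n))\<^sup>2) has_sum zeta 2) UNIV"
    by (rule sums_nonneg_imp_has_sum[OF zeta_2_sums]) simp
  moreover have "bij_betw Suc UNIV {n. n > 0}"
    by (auto simp: bij_betw_def image_iff gr0_conv_Suc)
  ultimately show ?case
    using has_sum_reindex_bij_betw[of Suc UNIV "{n. n > 0}" "\<lambda>n. 1 / (real n)\<^sup>2" "zeta 2"] by simp
next
  case (insert p S)
  define X where "X = {n. n > 0 \<and> (\<forall>p\<in>S. \<not> p dvd n)}"
  define z where "z = zeta 2 * (\<Prod>p\<in>S. 1 - 1 / (real p)\<^sup>2)"
  have p: "prime p" and S: "\<And>r. r \<in> S \<Longrightarrow> prime r" using insert by auto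
  have X: "((\<lambda>n. 1 / (real n)\<^sup>2) has_sum z) X"
    using insert S by (simp add: X_def z_def)
  have "((\<lambda>n. 1 / (real p)\<^sup>2 * (1 / (real n)\<^sup>2)) has_sum (1 / (real p)\<^sup>2 * z)) X"
    by (rule has_sum_cmult_right[OF X])
  then have "((\<lambda>n. 1 / (real (p * n))\<^sup>2) has_sum (1 / (real p)\<^sup>2 * z)) X"
    by (simp add: power_mult_distrib)
  then have pX: "((\<lambda>n. 1 / (real n)\<^sup>2) has_sum (1 / (real p)\<^sup>2 * z)) ((\<lambda>n. p * n) ` X)"
    using p by (subst has_sum_reindex) (auto simp: inj_on_def o_def)
  have ndvd: "\<not> r dvd p * n" if "r \<in> S" "\<not> r dvd n" for r n
    using that S[OF that(1)] p insert.hyps(2) prime_dvd_mult_iff[of r p n] primes_dvd_imp_eq[of r p] by auto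
  have sub: "(\<lambda>n. p * n) ` X \<subseteq> X"
    using ndvd prime_gt_0_nat[OF p] by (auto simp: X_def)
  have eq: "X - (\<lambda>n. p * n) ` X = {n. n > 0 \<and> (\<forall>r\<in>insert p S. \<not> r dvd n)}"
  proof (rule Set.set_eqI)
    fix n
    have "n \<in> (\<lambda>n. p * n) ` X" if n: "n \<in> X" "p dvd n"
    proof -
      from n(2) obtain k where k: "n = p * k" ..
      with n(1) have "k \<in> X" by (auto simp: X_def)
      with k show ?thesis by blast
    qed
    then show "n \<in> X - (\<lambda>n. p * n) ` X \<longleftrightarrow> n \<in> {n. n > 0 \<and> (\<forall>r\<in>insert p S. \<not> r dvd n)}"
      by (auto simp: X_def)
  qed
  show ?case
    using has_sum_Diff[OF X pX sub] insert.hyps unfolding eq by (simp add: z_def algebra_simps)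
qed

text \<open>An integer free of primes up to \<open>P\<close> is \<open>1\<close> or exceeds
  \<open>P\<close>. The sieved sum is therefore squeezed between \<open>1\<close> and
  \<open>1 + 1 / P\<close>.\<close>

lemma euler_product_zeta_2:
  "(\<lambda>P. \<Prod>p | prime p \<and> p \<le> P. 1 - 1 / (real p)\<^sup>2) \<longlonglongrightarrow> 1 / zeta 2"
proof -
  define f where "f P = (\<Prod>p | prime p \<and> p \<le> P. 1 - 1 / (real p)\<^sup>2)" for P :: nat
  have bounds: "1 \<le> zeta 2 * f P \<and> zeta 2 * f P \<le> 1 + 1 / real P" if "P > 0" for P
  proof
    let ?S = "{p. prime p \<and> p \<le> P}"
    let ?X = "{n. n > 0 \<and> (\<forall>p\<in>?S. \<not> p dvd n)}"
    have sum: "((\<lambda>n. 1 / (real n)\<^sup>2) has_sum (zeta 2 * f P)) ?X"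
      unfolding f_def by (rule has_sum_inverse_squares_sieved) auto
    have "1 \<in> ?X" by (auto dest: prime_gt_1_nat)
    moreover have "((\<lambda>n. 1 / (real n)\<^sup>2) has_sum (\<Sum>n\<in>{1}. 1 / (real n)\<^sup>2)) {1 :: nat}"
      by (rule has_sum_finite) simp
    ultimately have "(\<Sum>n\<in>{1 :: nat}. 1 / (real n)\<^sup>2) \<le> zeta 2 * f P"
      by (intro has_sum_mono_neutral[OF _ sum]) auto
    then show "1 \<le> zeta 2 * f P" by simp
    show "zeta 2 * f P \<le> 1 + 1 / real P"
    proof (rule has_sum_le_finite_sums[OF sum])
      fix F assume F: "finite F" "F \<subseteq> ?X"
      \<comment> \<open>Inserting \<open>0\<close> keeps \<open>Max\<close> meaningful when
        \<open>F\<close> is empty.\<close>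
      have "F \<subseteq> insert 1 {P<..Max (insert 0 F)}"
      proof
        fix n assume n: "n \<in> F"
        then have nX: "n > 0" "\<And>p. prime p \<Longrightarrow> p \<le> P \<Longrightarrow> \<not> p dvd n" using F by auto
        have "n \<le> Max (insert 0 F)" using n F by simp
        moreover have "P < n" if "n \<noteq> 1" (is ?neq)
        proof (rule ccontr)
          assume "\<not> P < n"
          moreover obtain p where "prime p" "p dvd n" using prime_factor_nat[OF \<open>?neq\<close>] by blast
          ultimately show False using nX dvd_imp_le[of p n] by auto
        qed
        ultimately show "n \<in> insert 1 {P<..Max (insert 0 F)}" by auto
      qed
      then have "(\<Sum>n\<in>F. 1 / (real n)\<^sup>2) \<le> (\<Sum>n\<in>insert 1 {P<..Max (insert 0 F)}. 1 / (real n)\<^sup>2)"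
        by (intro sum_mono2) auto
      also have "\<dots> = 1 + (\<Sum>n\<in>{P<..Max (insert 0 F)}. 1 / (real n)\<^sup>2)"
        using that by (subst sum.insert) auto
      also have "\<dots> \<le> 1 + 1 / real P" by (intro add_left_mono sum_inverse_squares_tail that)
      finally show "(\<Sum>n\<in>F. 1 / (real n)\<^sup>2) \<le> 1 + 1 / real P" .
    qed
  qed
  have "(\<lambda>P. zeta 2 * f P) \<longlonglongrightarrow> 1"
  proof (rule tendsto_sandwich)
    show "\<forall>\<^sub>F P in sequentially. 1 \<le> zeta 2 * f P" "\<forall>\<^sub>F P in sequentially. zeta 2 * f P \<le> 1 + 1 / real P"
      using bounds by (auto intro!: eventually_mono[OF eventually_gt_at_top[of 0]])
    show "(\<lambda>P. 1 + 1 / real P) \<longlonglongrightarrow> 1"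
      using tendsto_add[OF tendsto_const lim_1_over_n, of 1] by simp
  qed simp
  from tendsto_divide[OF this tendsto_const, of "zeta 2"] show ?thesis
    using zeta_2_pos by (simp add: f_def)
qed

text \<open>Primes dividing \<open>b^3 - b\<close> are left out: they divide neither an element of
  \<open>H b\<close> nor its reverse, and equidistribution is available only for moduli coprime to
  \<open>b^3 - b\<close>.\<close>

definition sieving_primes :: "nat \<Rightarrow> nat \<Rightarrow> nat set" where
  "sieving_primes b P = {p. prime p \<and> p \<le> P \<and> \<not> p dvd b ^ 3 - b}"

text \<open>The square of the Euler product of \<open>1 - 1/p^2\<close> over all primes not dividing
  \<open>b^3 - b\<close>, one factor for \<open>n\<close> and one for its reverse.\<close>

definition limit_density :: "nat \<Rightarrow> real" where
  "limit_density b = 1 / (zeta 2)\<^sup>2 *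
     (\<Prod>p\<in>{p::nat. prime p \<and> p dvd b ^ 3 - b}. (1 - 1 / (real p)\<^sup>2) powi (-2))"

section \<open>Convergence of the sieving densities\<close>

lemma cube_minus_base_pos: "b \<ge> 2 \<Longrightarrow> b ^ 3 - b > 0" for b :: nat
  using power_strict_increasing[of 1 3 b] by simp

lemma prime_euler_factor_pos: "prime p \<Longrightarrow> 1 - 1 / (real p)\<^sup>2 > 0"
  using prime_gt_1_nat[of p] by (simp add: power_less_one_iff divide_simps one_less_power)

lemma limit_density_pos: "limit_density b > 0"
proof -
  have "1 / (zeta 2)\<^sup>2 > 0" using zeta_2_pos by simp
  then show ?thesis
    unfolding limit_density_def
    by (intro mult_pos_pos prod_pos zero_less_power_int) (blast intro: prime_euler_factor_pos)+
qed

text \<open>Once \<open>P >= b^3 - b\<close>, every prime divisor of \<open>b^3 - b\<close> is at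
  most \<open>P\<close>, so the sieving product is the full Euler product divided by a fixed finite
  one.\<close>

lemma sieving_density_tendsto:
  assumes "b \<ge> 2"
  shows "(\<lambda>P. (\<Prod>p\<in>sieving_primes b P. 1 - 1 / (real p)\<^sup>2)\<^sup>2) \<longlonglongrightarrow> limit_density b"
proof -
  define B where "B = {p::nat. prime p \<and> p dvd b ^ 3 - b}"
  define g where "g = (\<lambda>p::nat. 1 - 1 / (real p)\<^sup>2)"
  have le: "p \<le> b ^ 3 - b" if "p \<in> B" for p
    using that cube_minus_base_pos[OF assms] by (auto simp: B_def intro: dvd_imp_le)
  then have "finite B" by (meson finite_nat_set_iff_bounded_le)
  have "prod g B > 0" unfolding g_def B_def by (intro prod_pos) (blast intro: prime_euler_factor_pos)
  then have nz: "prod g B \<noteq> 0" by simp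
  have "\<forall>\<^sub>F P in sequentially. ((\<Prod>p | prime p \<and> p \<le> P. g p) / prod g B)\<^sup>2 = (\<Prod>p\<in>sieving_primes b P. g p)\<^sup>2"
    using eventually_ge_at_top[of "b ^ 3 - b"]
  proof eventually_elim
    case (elim P)
    have "{p. prime p \<and> p \<le> P} = sieving_primes b P \<union> B"
      using le[THEN order_trans, OF _ elim] by (auto simp: sieving_primes_def B_def)
    moreover have "sieving_primes b P \<inter> B = {}" "finite (sieving_primes b P)"
      by (auto simp: sieving_primes_def B_def)
    ultimately have "(\<Prod>p | prime p \<and> p \<le> P. g p) = prod g (sieving_primes b P) * prod g B"
      using \<open>finite B\<close> by (simp add: prod.union_disjoint)
    then show ?case using nz by simp
  qed
  moreover have "(\<lambda>P. ((\<Prod>p | prime p \<and> p \<le> P. g p) / prod g B)\<^sup>2) \<longlonglongrightarrow> (1 / zeta 2 / prod g B)\<^sup>2"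
    unfolding g_def using nz[unfolded g_def] by (intro tendsto_power tendsto_divide euler_product_zeta_2 tendsto_const)
  moreover have "(\<Prod>p\<in>B. g p powi (-2)) = 1 / (prod g B)\<^sup>2"
  proof -
    have "(\<Prod>p\<in>B. g p powi (-2)) = (\<Prod>p\<in>B. 1 / (g p)\<^sup>2)"
      by (simp add: power_int_minus divide_inverse)
    also have "\<dots> = 1 / (prod g B)\<^sup>2" by (simp add: prod_dividef prod_power_distrib)
    finally show ?thesis .
  qed
  then have "(1 / zeta 2 / prod g B)\<^sup>2 = limit_density b"
    unfolding limit_density_def B_def[symmetric] by (simp add: g_def power_divide power_mult_distrib)
  ultimately show ?thesis
    unfolding g_def by (auto intro: Lim_transform_eventually)
qed

text \<open>If the sieve misses a square factor \<open>p^2\<close> of \<open>n\<close> or its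
  reverse, then \<open>p\<close> does not divide \<open>b^3 - b\<close> by membership in
  \<open>H b\<close>, which leaves only \<open>p > P\<close>.\<close>

lemma squarefree_sieve:
  fixes b n P :: nat
  assumes "b \<ge> 2" "n \<in> H b"
  defines "A \<equiv> \<lambda>n. \<forall>p\<in>sieving_primes b P. \<not> p\<^sup>2 dvd n"
  shows "squarefree n \<and> squarefree (reverse_base b n) \<Longrightarrow> A n \<and> A (reverse_base b n)"
    and "A n \<and> A (reverse_base b n) \<Longrightarrow> \<not> (squarefree n \<and> squarefree (reverse_base b n)) \<Longrightarrow>
      \<exists>d>P. d\<^sup>2 dvd n \<or> d\<^sup>2 dvd reverse_base b n"
proof -
  show "squarefree n \<and> squarefree (reverse_base b n) \<Longrightarrow> A n \<and> A (reverse_base b n)"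
    by (auto simp: A_def sieving_primes_def dest: squarefreeD)
  have large: "\<exists>d>P. d\<^sup>2 dvd m" if m: "A m" "\<not> squarefree m" "coprime m (b ^ 3 - b)" "m > 0" for m
  proof -
    obtain p where p: "prime p" "p\<^sup>2 dvd m"
      using m squarefree_factorial_semiring[of m] by auto
    then have "p dvd m" by (metis dvd_triv_left dvd_trans power2_eq_square)
    then have ndvd: "\<not> p dvd b ^ 3 - b"
      using coprime_common_divisor_nat[OF m(3)] p(1) not_prime_1 by blast
    have "p \<notin> sieving_primes b P" using m(1) p(2) unfolding A_def by blast
    then have "p > P" using p(1) ndvd unfolding sieving_primes_def mem_Collect_eq not_le[symmetric] by blast
    with p show ?thesis by blast
  qed
  have "coprime n (b ^ 3 - b)" "coprime (reverse_base b n) (b ^ 3 - b)" "n > 0"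
    using assms(2) unfolding H_def coprime_iff_gcd_eq_1 by auto
  moreover have "reverse_base b n > 0"
    using calculation(2) cube_minus_base_pos[OF assms(1)] assms(1,2)
    by (cases "reverse_base b n") (auto simp: mem_H_iff)
  ultimately show "A n \<and> A (reverse_base b n) \<Longrightarrow> \<not> (squarefree n \<and> squarefree (reverse_base b n)) \<Longrightarrow>
      \<exists>d>P. d\<^sup>2 dvd n \<or> d\<^sup>2 dvd reverse_base b n"
    using large[of n] large[of "reverse_base b n"] by blast
qed

text \<open>Equidistribution is applied with the same sieve condition for \<open>n\<close> and its
  reverse, hence the squared product. The last error term pays for the primes beyond
  \<open>P\<close>; \<open>C\<close> depends on \<open>P\<close> and \<open>e\<close> but not on
  \<open>N\<close>.\<close>

lemma H_squarefree_sieve_bound: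
  assumes b: "b \<ge> 2" and P: "P > 0" and e: "e > 0"
  obtains C where "\<And>N. \<bar>(\<Sum>n<N. of_bool (n \<in> H b \<and> squarefree n \<and> squarefree (reverse_base b n))) -
    (\<Prod>p\<in>sieving_primes b P. 1 - 1 / (real p)\<^sup>2)\<^sup>2 * (\<Sum>n<N. of_bool (n \<in> H b))\<bar>
    \<le> e * real N + C + (1 + real b) * real N / real P"
proof -
  define S where "S = sieving_primes b P"
  define A where "A n = (\<forall>p\<in>S. \<not> p\<^sup>2 dvd n)" for n
  define q where "q = (\<Prod>p\<in>S. p\<^sup>2)"
  have S: "finite S" "\<And>p. p \<in> S \<Longrightarrow> prime p" by (auto simp: S_def sieving_primes_def)
  have q0: "q > 0" unfolding q_def using S by (intro prod_pos) (auto simp: prime_gt_0_nat)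
  have "coprime (b ^ 3 - b) q"
    unfolding q_def
  proof (rule prod_coprime_right)
    fix p assume "p \<in> S"
    then show "coprime (b ^ 3 - b) (p\<^sup>2)"
      by (auto simp: S_def sieving_primes_def prime_imp_coprime coprime_commute)
  qed
  then have q: "coprime b q" "coprime (b * b - 1) q"
    by (auto simp: cube_minus_base)
  have A: "A (u mod q) = A u" for u
  proof -
    have "r\<^sup>2 dvd u mod q \<longleftrightarrow> r\<^sup>2 dvd u" if "r \<in> S" for r
      using that S by (intro dvd_mod_iff) (auto simp: q_def intro: dvd_prodI)
    then show ?thesis by (auto simp: A_def)
  qed
  have avg: "residue_average q A = (\<Prod>p\<in>S. 1 - 1 / (real p)\<^sup>2)"
    using residue_average_prime_squares[OF S] by (simp add: q_def A_def[abs_def])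
  obtain C where C: "\<And>N. \<bar>(\<Sum>n<N. of_bool (n \<in> H b \<and> A n \<and> A (reverse_base b n))) -
    residue_average q A * residue_average q A * (\<Sum>n<N. of_bool (n \<in> H b))\<bar> \<le> e * real N + C"
    by (rule H_equidistributed[of b q e A A, OF b q0 q e A A]) (rule that)
  show thesis
  proof (rule that[of C])
    fix N
    let ?sf = "\<lambda>n. squarefree n \<and> squarefree (reverse_base b n)"
    let ?X = "{n. n < N \<and> n \<in> H b \<and> ?sf n}"
    let ?Y = "{n. n < N \<and> n \<in> H b \<and> A n \<and> A (reverse_base b n)}"
    let ?Z = "{n. n < N \<and> n \<in> H b \<and> (\<exists>d>P. d\<^sup>2 dvd n \<or> d\<^sup>2 dvd reverse_base b n)}"
    note sieve = squarefree_sieve[OF b, where P = P, folded S_def]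
    have "card ?X \<le> card ?Y" using sieve(1) by (intro card_mono) (auto simp: A_def)
    moreover have "card ?Y \<le> card (?X \<union> ?Z)" using sieve(2) by (intro card_mono) (auto simp: A_def)
    moreover have "card (?X \<union> ?Z) \<le> card ?X + card ?Z" by (rule card_Un_le)
    ultimately have "\<bar>real (card ?X) - real (card ?Y)\<bar> \<le> real (card ?Z)" by linarith
    also have "\<dots> \<le> (1 + real b) * real N / real P"
      by (rule card_H_large_square_divisor_le[OF b P])
    finally show "\<bar>(\<Sum>n<N. of_bool (n \<in> H b \<and> ?sf n)) -
        (\<Prod>p\<in>sieving_primes b P. 1 - 1 / (real p)\<^sup>2)\<^sup>2 * (\<Sum>n<N. of_bool (n \<in> H b))\<bar>
      \<le> e * real N + C + (1 + real b) * real N / real P"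
      using C[of N] unfolding avg S_def[symmetric] power2_eq_square
      unfolding sum_of_bool_eq_card by linarith
  qed
qed

text \<open>The parameters are fixed in the order \<open>P\<close>, then \<open>C\<close>, then
  \<open>N\<close>. The lower bound \<open>c * N\<close> for the count of \<open>H b\<close> turns
  errors proportional to \<open>N\<close> into relative ones.\<close>

lemma H_squarefree_density:
  assumes b: "b \<ge> 2"
  shows "(\<lambda>N. (\<Sum>n<N. of_bool (n \<in> H b \<and> squarefree n \<and> squarefree (reverse_base b n))) /
    (\<Sum>n<N. of_bool (n \<in> H b))) \<longlonglongrightarrow> limit_density b"
proof (rule LIMSEQ_I)
  fix r :: real assume r: "r > 0"
  let ?f = "\<lambda>P. (\<Prod>p\<in>sieving_primes b P. 1 - 1 / (real p)\<^sup>2)\<^sup>2"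
  let ?h = "\<lambda>N. \<Sum>n<N. of_bool (n \<in> H b) :: real"
  let ?s = "\<lambda>N. \<Sum>n<N. of_bool (n \<in> H b \<and> squarefree n \<and> squarefree (reverse_base b n)) :: real"
  obtain c N0 where c: "c > 0" "\<And>N. N \<ge> N0 \<Longrightarrow> c * real N \<le> ?h N"
    using H_count_lower_bound[OF b] by metis
  have "\<forall>\<^sub>F P in sequentially. dist (?f P) (limit_density b) < r / 4"
    using sieving_density_tendsto[OF b] r by (intro tendstoD) auto
  moreover have "(\<lambda>P. (1 + real b) / real P) \<longlonglongrightarrow> 0"
    by (rule lim_const_over_n)
  then have "\<forall>\<^sub>F P in sequentially. dist ((1 + real b) / real P) 0 < c * r / 4"
    using c r by (intro tendstoD) auto
  ultimately have "\<forall>\<^sub>F P in sequentially. dist (?f P) (limit_density b) < r / 4 \<and>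
      dist ((1 + real b) / real P) 0 < c * r / 4 \<and> P > 0"
    using eventually_gt_at_top[of 0] by eventually_elim auto
  \<comment> \<open>The budget \<open>r\<close> is split into four: the distance of the sieve
    density from its limit, the primes beyond \<open>P\<close>, the equidistribution error and the
    constant \<open>C\<close>.\<close>
  then obtain P where P: "dist (?f P) (limit_density b) < r / 4" "(1 + real b) / real P < c * r / 4" "P > 0"
    by (auto simp: eventually_at_top_linorder dist_real_def)
  have e: "c * r / 4 > 0" using c r by simp
  obtain C where C: "\<And>N. \<bar>?s N - ?f P * ?h N\<bar> \<le> c * r / 4 * real N + C + (1 + real b) * real N / real P"
    by (rule H_squarefree_sieve_bound[OF b P(3) e]) (rule that)
  obtain N1 where N1: "real N1 > 4 * C / (c * r)" using reals_Archimedean2 by blast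
  show "\<exists>no. \<forall>N\<ge>no. norm (?s N / ?h N - limit_density b) < r"
  proof (intro exI allI impI)
    fix N assume N: "N \<ge> Max {N0, N1, 1}"
    then have N': "N \<ge> N0" "N \<ge> N1" "real N > 0" by auto
    have h: "?h N \<ge> c * real N" by (rule c(2)[OF N'(1)])
    have h_pos: "?h N > 0" by (rule less_le_trans[OF mult_pos_pos[OF c(1) N'(3)] h])
    have "(1 + real b) / real P * real N \<le> c * r / 4 * real N"
      using P(2) by (intro mult_right_mono) auto
    moreover have "C \<le> c * r / 4 * real N"
    proof -
      have "4 * C / (c * r) < real N" using N1 N'(2) by linarith
      then show ?thesis using c(1) r by (simp add: pos_divide_less_eq mult_ac)
    qed
    moreover have "(1 + real b) / real P * real N = (1 + real b) * real N / real P"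
        "3 * (r / 4) * (c * real N) = 3 * (c * r / 4 * real N)" by simp_all
    ultimately have "\<bar>?s N - ?f P * ?h N\<bar> \<le> 3 * (r / 4) * (c * real N)"
      using C[of N] by linarith
    also have "\<dots> \<le> 3 * (r / 4) * ?h N" using h r by (intro mult_left_mono) auto
    finally have "\<bar>?s N - ?f P * ?h N\<bar> / ?h N \<le> 3 * (r / 4)"
      using h_pos by (simp only: pos_divide_le_eq)
    moreover have "\<bar>?s N / ?h N - ?f P\<bar> = \<bar>?s N - ?f P * ?h N\<bar> / ?h N"
    proof -
      have "?s N / ?h N - ?f P = (?s N - ?f P * ?h N) / ?h N"
        using h_pos by (simp only: diff_divide_distrib nonzero_mult_div_cancel_right[OF less_imp_neq[THEN not_sym]])
      then show ?thesis using h_pos by (simp only: abs_divide abs_of_pos)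
    qed
    ultimately have "\<bar>?s N / ?h N - ?f P\<bar> \<le> 3 * (r / 4)" by (simp only:)
    moreover have "\<bar>y - l\<bar> < r" if "\<bar>y - f\<bar> \<le> 3 * (r / 4)" "\<bar>f - l\<bar> < r / 4" for y f l :: real
      using that by linarith
    ultimately show "norm (?s N / ?h N - limit_density b) < r"
      using P(1) unfolding dist_real_def real_norm_def by blast
  qed
qed

theorem theorem1p5:
  fixes b :: nat
  assumes "b \<ge> 2"
  shows "(\<lambda>x::real. \<Sum>n\<in>{n \<in> up_to (H b) x. squarefree n \<and> squarefree (reverse_base b n)}. 1 :: real)
    \<sim>[at_top]
    (\<lambda>x::real. real (card (up_to (H b) x)) / (zeta 2)\<^sup>2 *
       (\<Prod>p\<in>{p::nat. prime p \<and> p dvd b ^ 3 - b}. (1 - 1 / (real p)\<^sup>2) powi (-2)))"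
proof -
  \<comment> \<open>The successor makes the strict range \<open>n < N x\<close> include the floor of
    \<open>x\<close>; for negative \<open>x\<close> only \<open>n = 0\<close> remains, which is not
    in \<open>H b\<close>.\<close>
  define N where "N x = Suc (nat \<lfloor>x\<rfloor>)" for x :: real
  let ?h = "\<lambda>N. \<Sum>n<N. of_bool (n \<in> H b) :: real"
  let ?s = "\<lambda>N. \<Sum>n<N. of_bool (n \<in> H b \<and> squarefree n \<and> squarefree (reverse_base b n)) :: real"
  have up_to: "up_to (H b) x = {n. n < N x \<and> n \<in> H b}" for x
  proof -
    have "n \<le> nat \<lfloor>x\<rfloor> \<longleftrightarrow> real n \<le> x" if "n \<ge> 1" for n
      using that by (cases "\<lfloor>x\<rfloor> \<ge> 0") (auto simp: le_nat_iff le_floor_iff)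
    then show ?thesis
      by (auto simp: up_to_def H_def N_def less_Suc_eq_le)
  qed
  have h: "real (card (up_to (H b) x)) = ?h (N x)" for x
    unfolding up_to sum_of_bool_eq_card ..
  have s: "(\<Sum>n\<in>{n \<in> up_to (H b) x. squarefree n \<and> squarefree (reverse_base b n)}. 1 :: real) = ?s (N x)" for x
    unfolding up_to sum_of_bool_eq_card by (simp add: conj_assoc)
  have "filterlim N at_top at_top"
    unfolding N_def
    by (intro filterlim_compose[OF filterlim_Suc] filterlim_compose[OF filterlim_nat_sequentially]
        filterlim_floor_sequentially)
  from filterlim_compose[OF H_squarefree_density[OF assms] this]
  have "((\<lambda>x. ?s (N x) / ?h (N x) / limit_density b) \<longlongrightarrow> limit_density b / limit_density b) at_top"
    using limit_density_pos[of b] by (intro tendsto_divide) auto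
  then have "((\<lambda>x. ?s (N x) / (?h (N x) * limit_density b)) \<longlongrightarrow> 1) at_top"
    using limit_density_pos[of b] by simp
  then have "(\<lambda>x. ?s (N x)) \<sim>[at_top] (\<lambda>x. ?h (N x) * limit_density b)"
    by (rule asymp_equivI')
  then show ?thesis
    unfolding s h limit_density_def by simp
qed

end
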